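(* Let $S$ be a sub-semifield of $\mathbb T$ and let $\mathcal M$ be the toric monoid corresponding to a strongly convex rational polyhedral cone $\sigma\subseteq N_{\mathbb R}$. Let $E$ be a congruence on $S[\mathcal M]$ with a finite tropical basis. Suppose that $\widetilde V(E)$ is the closure of $\widetilde V(E)\cap(\mathbb R_{\ge0}\times N_{\mathbb R})$ in $\mathbb R_{\ge0}\times N_{\mathbb R}(\sigma)$. Then every minimal prime congruence of $S[\mathcal M]/E$ has trivial ideal-kernel.
   Context: Semirings are commutative, with $0$ and $1$, and additively idempotent; they are partially ordered by $a\le b\iff a+b=b$. $\mathbb{T}=\mathbb{R}\cup\{-\infty\}$ is the tropical semifield (addition is max, multiplication is usual addition, $0_{\mathbb T}=-\infty$); $\log:\mathbb{T}\to\mathbb{R}\cup\{-\infty\}$ is the tautological identification, with $\log 0_{\mathbb T}=-\infty$. Toric data: $M$ is a finitely generated free abelian group, $M_{\mathbb R}=M\otimes\mathbb R$, $N_{\mathbb R}=\mathrm{Hom}(M,\mathbb R)$ with pairing $\langle v,u\rangle=v(u)$. For $\sigma\subseteq N_{\mathbb R}$ a strongly convex rational polyhedral cone, $\sigma^\vee=\{u\in M_{\mathbb R}:\langle v,u\rangle\le 0\ \forall v\in\sigma\}$, and the toric monoid corresponding to $\sigma$ is $\mathcal{M}=\sigma^\vee\cap M$. $N_{\mathbb R}(\sigma)$ is the set of monoid homomorphisms $\mathcal{M}\to(\mathbb R\cup\{-\infty\},+)$, with $\langle x,u\rangle=x(u)$, topologized as a subspace of the product $(\mathbb R\cup\{-\infty\})^{\mathcal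 M}$, where $\mathbb R\cup\{-\infty\}$ is given the topology of $[0,\infty)$ via $x\mapsto e^x$. $N_{\mathbb R}\subseteq N_{\mathbb R}(\sigma)$ is identified with the homomorphisms having only finite values. For $f=\sum_u f_u\chi^u\in S[\mathcal M]$ and $(r,x)\in\mathbb R_{\ge0}\times N_{\mathbb R}(\sigma)$, $\widetilde f(r,x)=\max_{u\in\mathrm{supp}(f)}\left(r\log(f_u)+\langle x,u\rangle\right)$ (equal to $-\infty$ if $f=0$). For $E\subseteq S[\mathcal M]^2$, $\widetilde V(E)=\{w\in\mathbb R_{\ge0}\times N_{\mathbb R}(\sigma):\widetilde f(w)=\widetilde g(w)\ \forall (f,g)\in E\}$. A congruence on a semiring $A$ is an equivalence relation respecting the operations. A proper congruence $P$ is prime if $A/P$ is totally ordered and cancellative (every nonzero element $a$ satisfies $ab=ac\Rightarrow b=c$); minimal primes are minimal with respect to inclusion. The ideal-kernel of a congruence $C$ on $A$ is $\{a\in A:(a,0)\in C\}$; it is trivial if it equals $\{0\}$. A congruence $E$ on $S[\mathcal M]$ has a finite tropical basis if there are $(f_1,g_1),\dots,(f_r,g_r)\in E$ with $\widetilde V(E)=\widetilde V(\{(f_1,g_1),\dots,(f_r,g_r)\})$. *)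

theory Defs
  imports
    "HOL-Analysis.Function_Topology"
    "HOL-Analysis.Product_Topology"
    "HOL-Library.Extended_Real"
    "HOL-Library.Poly_Mapping"
    "HOL-Algebra.Ring"
begin

section \<open>Congruences on semirings\<close>

text \<open>Semirings are the carrier-based structures of the locale \<open>semiring\<close>; this makes it
  possible to iterate quotients. All the semirings considered are moreover commutative and
  additively idempotent.\<close>

definition congruence :: "('a, 'b) ring_scheme \<Rightarrow> ('a \<times> 'a) set \<Rightarrow> bool" where
  "congruence R C \<longleftrightarrow> equiv (carrier R) C \<and>
     (\<forall>a b c d. (a, b) \<in> C \<longrightarrow> (c, d) \<in> C \<longrightarrow>
        (a \<oplus>\<^bsub>R\<^esub> c, b \<oplus>\<^bsub>R\<^esub> d) \<in> C \<and> (a \<otimes>\<^bsub>R\<^esub> c, b \<otimes>\<^bsub>R\<^esub> d) \<in> C)"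

definition quot_semiring :: "('a, 'b) ring_scheme \<Rightarrow> ('a \<times> 'a) set \<Rightarrow> 'a set ring" where
  "quot_semiring R C =
     \<lparr>carrier = carrier R // C,
      mult = (\<lambda>X Y. \<Union>a\<in>X. \<Union>b\<in>Y. C `` {a \<otimes>\<^bsub>R\<^esub> b}),
      one = C `` {\<one>\<^bsub>R\<^esub>},
      zero = C `` {\<zero>\<^bsub>R\<^esub>},
      add = (\<lambda>X Y. \<Union>a\<in>X. \<Union>b\<in>Y. C `` {a \<oplus>\<^bsub>R\<^esub> b})\<rparr>"

definition semiring_le :: "('a, 'b) ring_scheme \<Rightarrow> 'a \<Rightarrow> 'a \<Rightarrow> bool" where
  "semiring_le R a b \<longleftrightarrow> a \<oplus>\<^bsub>R\<^esub> b = b"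

definition totally_ordered_semiring :: "('a, 'b) ring_scheme \<Rightarrow> bool" where
  "totally_ordered_semiring R \<longleftrightarrow>
     (\<forall>a\<in>carrier R. \<forall>b\<in>carrier R. semiring_le R a b \<or> semiring_le R b a)"

definition cancellative_semiring :: "('a, 'b) ring_scheme \<Rightarrow> bool" where
  "cancellative_semiring R \<longleftrightarrow>
     (\<forall>a\<in>carrier R. a \<noteq> \<zero>\<^bsub>R\<^esub> \<longrightarrow>
        (\<forall>b\<in>carrier R. \<forall>c\<in>carrier R. a \<otimes>\<^bsub>R\<^esub> b = a \<otimes>\<^bsub>R\<^esub> c \<longrightarrow> b = c))"

definition proper_congruence :: "('a, 'b) ring_scheme \<Rightarrow> ('a \<times> 'a) set \<Rightarrow> bool" where
  "proper_congruence R C \<longleftrightarrow> congruence R C \<and> C \<noteq> carrier R \<times> carrier R"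

definition prime_congruence :: "('a, 'b) ring_scheme \<Rightarrow> ('a \<times> 'a) set \<Rightarrow> bool" where
  "prime_congruence R P \<longleftrightarrow> proper_congruence R P \<and>
     totally_ordered_semiring (quot_semiring R P) \<and> cancellative_semiring (quot_semiring R P)"

definition minimal_prime_congruence :: "('a, 'b) ring_scheme \<Rightarrow> ('a \<times> 'a) set \<Rightarrow> bool" where
  "minimal_prime_congruence R P \<longleftrightarrow>
     prime_congruence R P \<and> (\<forall>Q. prime_congruence R Q \<longrightarrow> Q \<subseteq> P \<longrightarrow> Q = P)"

definition ideal_kernel :: "('a, 'b) ring_scheme \<Rightarrow> ('a \<times> 'a) set \<Rightarrow> 'a set" where
  "ideal_kernel R C = {a \<in> carrier R. (a, \<zero>\<^bsub>R\<^esub>) \<in> C}"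

lemma congruenceD:
  assumes "congruence R C"
  shows "equiv (carrier R) C"
    "(a, b) \<in> C \<Longrightarrow> (c, d) \<in> C \<Longrightarrow> (a \<oplus>\<^bsub>R\<^esub> c, b \<oplus>\<^bsub>R\<^esub> d) \<in> C"
    "(a, b) \<in> C \<Longrightarrow> (c, d) \<in> C \<Longrightarrow> (a \<otimes>\<^bsub>R\<^esub> c, b \<otimes>\<^bsub>R\<^esub> d) \<in> C"
  using assms unfolding congruence_def by blast+

lemma quot_semiring_class_ops:
  assumes "congruence R C" "a \<in> carrier R" "b \<in> carrier R"
  shows "C `` {a} \<oplus>\<^bsub>quot_semiring R C\<^esub> C `` {b} = C `` {a \<oplus>\<^bsub>R\<^esub> b}"
    and "C `` {a} \<otimes>\<^bsub>quot_semiring R C\<^esub> C `` {b} = C `` {a \<otimes>\<^bsub>R\<^esub> b}"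
proof -
  note eq = congruenceD(1)[OF assms(1)]
  have c2: "congruent2 C C (\<lambda>x y. C `` {x \<oplus>\<^bsub>R\<^esub> y})" "congruent2 C C (\<lambda>x y. C `` {x \<otimes>\<^bsub>R\<^esub> y})"
    using congruenceD(2,3)[OF assms(1)] equiv_class_eq[OF eq]
    unfolding congruent2_def by blast+
  show "C `` {a} \<oplus>\<^bsub>quot_semiring R C\<^esub> C `` {b} = C `` {a \<oplus>\<^bsub>R\<^esub> b}"
    and "C `` {a} \<otimes>\<^bsub>quot_semiring R C\<^esub> C `` {b} = C `` {a \<otimes>\<^bsub>R\<^esub> b}"
    unfolding quot_semiring_def
    using UN_equiv_class2[OF eq eq c2(1) assms(2,3)] UN_equiv_class2[OF eq eq c2(2) assms(2,3)]
    by simp_all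
qed

lemma semiring_quot_semiring:
  assumes "semiring R" "congruence R C"
  shows "semiring (quot_semiring R C)"
proof -
  interpret semiring R by fact
  let ?Q = "quot_semiring R C"
  note ops = quot_semiring_class_ops[OF assms(2)]
  have car: "carrier ?Q = (\<lambda>a. C `` {a}) ` carrier R"
    by (auto simp: quot_semiring_def quotient_def)
  have one: "\<one>\<^bsub>?Q\<^esub> = C `` {\<one>\<^bsub>R\<^esub>}" and zero: "\<zero>\<^bsub>?Q\<^esub> = C `` {\<zero>\<^bsub>R\<^esub>}"
    by (simp_all add: quot_semiring_def)
  show ?thesis
  proof (intro semiring.intro abelian_monoidI Group.monoidI semiring_axioms.intro)
    fix X Y assume "X \<in> carrier ?Q" "Y \<in> carrier ?Q"
    then obtain a b where "a \<in> carrier R" "X = C `` {a}" "b \<in> carrier R" "Y = C `` {b}"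
      unfolding car by blast
    then show "X \<oplus>\<^bsub>?Q\<^esub> Y \<in> carrier ?Q" "X \<otimes>\<^bsub>?Q\<^esub> Y \<in> carrier ?Q"
      "X \<oplus>\<^bsub>?Q\<^esub> Y = Y \<oplus>\<^bsub>?Q\<^esub> X"
      by (simp_all add: ops car a_comm)
  next
    fix X Y Z assume "X \<in> carrier ?Q" "Y \<in> carrier ?Q" "Z \<in> carrier ?Q"
    then obtain a b c where "a \<in> carrier R" "X = C `` {a}" "b \<in> carrier R" "Y = C `` {b}"
      "c \<in> carrier R" "Z = C `` {c}"
      unfolding car by blast
    then show "X \<oplus>\<^bsub>?Q\<^esub> Y \<oplus>\<^bsub>?Q\<^esub> Z = X \<oplus>\<^bsub>?Q\<^esub> (Y \<oplus>\<^bsub>?Q\<^esub> Z)"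
      "X \<otimes>\<^bsub>?Q\<^esub> Y \<otimes>\<^bsub>?Q\<^esub> Z = X \<otimes>\<^bsub>?Q\<^esub> (Y \<otimes>\<^bsub>?Q\<^esub> Z)"
      "(X \<oplus>\<^bsub>?Q\<^esub> Y) \<otimes>\<^bsub>?Q\<^esub> Z = X \<otimes>\<^bsub>?Q\<^esub> Z \<oplus>\<^bsub>?Q\<^esub> Y \<otimes>\<^bsub>?Q\<^esub> Z"
      "Z \<otimes>\<^bsub>?Q\<^esub> (X \<oplus>\<^bsub>?Q\<^esub> Y) = Z \<otimes>\<^bsub>?Q\<^esub> X \<oplus>\<^bsub>?Q\<^esub> Z \<otimes>\<^bsub>?Q\<^esub> Y"
      by (simp_all add: ops a_assoc m_assoc l_distr r_distr)
  qed (auto simp: car one zero ops)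
qed

section \<open>The tropical semifield\<close>

text \<open>The type \<open>trop\<close> is a copy of the subset of the extended reals without \<open>\<infinity>\<close>. The
  representation morphism is the tautological identification \<open>trop_log\<close>; addition on
  \<open>trop\<close> is the maximum, multiplication the usual addition.\<close>

typedef trop = "{x::ereal. x \<noteq> \<infinity>}"
  morphisms trop_log trop_of_ereal
  by (rule exI[of _ 0]) simp

setup_lifting type_definition_trop

instantiation trop :: comm_semiring_1
begin

lift_definition zero_trop :: trop is "-\<infinity>" by simp
lift_definition one_trop :: trop is "0" by simp
lift_definition plus_trop :: "trop \<Rightarrow> trop \<Rightarrow> trop" is "\<lambda>x y. max x y" by (simp add: max_def)
lift_definition times_trop :: "trop \<Rightarrow> trop \<Rightarrow> trop" is "\<lambda>x y. x + y" by simp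

instance
proof
  fix a b c :: trop
  show "a * b * c = a * (b * c)" by transfer (simp add: add.assoc)
  show "a * b = b * a" by transfer (simp add: add.commute)
  show "1 * a = a" by transfer simp
  show "a + b + c = a + (b + c)" by transfer (simp add: max.assoc)
  show "a + b = b + a" by transfer (simp add: max.commute)
  show "0 + a = a" by transfer simp
  show "(a + b) * c = a * c + b * c"
    by transfer (auto simp: max_def not_le intro!: antisym intro: add_right_mono less_imp_le)
  show "0 * a = 0" by transfer simp
  show "a * 0 = 0" by transfer simp
  show "(0::trop) \<noteq> 1" by transfer simp
qed

end

definition sub_semifield :: "trop set \<Rightarrow> bool" where
  "sub_semifield S \<longleftrightarrow> 0 \<in> S \<and> 1 \<in> S \<and>
     (\<forall>a\<in>S. \<forall>b\<in>S. a + b \<in> S \<and> a * b \<in> S) \<and>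
     (\<forall>a\<in>S. a \<noteq> 0 \<longrightarrow> (\<exists>b\<in>S. a * b = 1))"

section \<open>Toric data\<close>

text \<open>The lattice \<open>M\<close> is a whole type of class \<open>ab_group_add\<close>, which is required to be free and
  finitely generated as a module over the integers (rank 0 is allowed).\<close>

definition int_scale :: "int \<Rightarrow> 'm::ab_group_add \<Rightarrow> 'm" where
  "int_scale n x = (\<Sum>i<nat n. x) - (\<Sum>i<nat (- n). x)"

lemma sum_const_add_lessThan:
  "(\<Sum>i<j + k. x) = (\<Sum>i<j. x) + (\<Sum>i<k. (x::'m::ab_group_add))" for j k :: nat
  by (induction k) (simp_all add: add.assoc)

lemma int_scale_diff:
  "int_scale (int j - int k) x = (\<Sum>i<j. x) - (\<Sum>i<k. (x::'m::ab_group_add))"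
proof (cases "k \<le> j")
  case True
  then obtain l where "j = k + l" using le_Suc_ex by blast
  then show ?thesis by (simp add: int_scale_def sum_const_add_lessThan)
next
  case False
  then obtain l where "k = j + l" using le_Suc_ex nat_le_linear by blast
  then show ?thesis by (simp add: int_scale_def sum_const_add_lessThan)
qed

global_interpretation int_mod: Modules.module int_scale
proof
  fix a b :: int and x y :: "'m::ab_group_add"
  show "int_scale a (x + y) = int_scale a x + int_scale a y"
    by (simp add: int_scale_def sum.distrib algebra_simps)
  have dist: "int_scale (a + b) x = int_scale a x + int_scale b x" for a b x
  proof -
    obtain j k where a: "a = int j - int k" by (metis int_diff_cases)
    obtain l m where b: "b = int l - int m" by (metis int_diff_cases)
    have "a + b = int (j + l) - int (k + m)" by (simp add: a b)
    then show ?thesis unfolding a b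
      by (simp only: int_scale_diff sum_const_add_lessThan) (simp add: algebra_simps)
  qed
  then show "int_scale (a + b) x = int_scale a x + int_scale b x" .
  have one: "int_scale 1 y = y" for y by (simp add: int_scale_def)
  then show "int_scale 1 x = x" .
  have zero: "int_scale 0 y = 0" for y by (simp add: int_scale_def)
  have minus: "int_scale (- 1) y = - y" for y by (simp add: int_scale_def)
  show "int_scale a (int_scale b x) = int_scale (a * b) x"
  proof (induction a rule: int_induct[of _ 0])
    case base
    then show ?case by (simp add: zero)
  next
    case (step1 i)
    have "int_scale (i + 1) (int_scale b x) = int_scale (i * b) x + int_scale b x"
      by (simp only: dist one step1)
    also have "\<dots> = int_scale ((i + 1) * b) x"
      by (simp add: dist[symmetric] algebra_simps)
    finally show ?case .
  next
    case (step2 i)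
    have "int_scale (i - 1) (int_scale b x) = int_scale (i * b) x - int_scale b x"
      using step2 dist[of i "- 1" "int_scale b x"] by (simp add: minus)
    also have "\<dots> = int_scale ((i - 1) * b) x"
      using dist[of "(i - 1) * b" b x] by (simp add: algebra_simps)
    finally show ?case .
  qed
qed

definition fg_free_abelian :: "'m::ab_group_add itself \<Rightarrow> bool" where
  "fg_free_abelian _ \<longleftrightarrow>
     (\<exists>B :: 'm set. finite B \<and> int_mod.independent B \<and> int_mod.span B = UNIV)"

text \<open>\<open>N_space\<close> is the space of group homomorphisms from \<open>M\<close> to the reals, with pairing
  \<open>\<langle>v, u\<rangle> = v u\<close>, and \<open>N_lattice\<close> is its lattice of integer-valued homomorphisms.\<close>

definition N_space :: "('m::ab_group_add \<Rightarrow> real) set" where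
  "N_space = {v. \<forall>u w. v (u + w) = v u + v w}"

definition N_lattice :: "('m::ab_group_add \<Rightarrow> real) set" where
  "N_lattice = {v \<in> N_space. \<forall>u. v u \<in> \<int>}"

definition cone_generated :: "('m::ab_group_add \<Rightarrow> real) set \<Rightarrow> ('m \<Rightarrow> real) set" where
  "cone_generated G = {\<lambda>u. \<Sum>v\<in>G. c v * v u | c. \<forall>v\<in>G. 0 \<le> c v}"

definition rational_polyhedral_cone :: "('m::ab_group_add \<Rightarrow> real) set \<Rightarrow> bool" where
  "rational_polyhedral_cone \<sigma> \<longleftrightarrow> (\<exists>G. finite G \<and> G \<subseteq> N_lattice \<and> \<sigma> = cone_generated G)"

definition strongly_convex :: "('m::ab_group_add \<Rightarrow> real) set \<Rightarrow> bool" where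
  "strongly_convex \<sigma> \<longleftrightarrow> \<sigma> \<inter> (\<lambda>v u. - v u) ` \<sigma> = {\<lambda>u. 0}"

text \<open>Since \<open>M\<close> is free it embeds in \<open>M \<otimes> \<real>\<close>, and the intersection of the dual cone (with the
  sign convention \<open>\<le> 0\<close>) with \<open>M\<close> can be described without the tensor product.\<close>

definition toric_monoid :: "('m::ab_group_add \<Rightarrow> real) set \<Rightarrow> 'm set" where
  "toric_monoid \<sigma> = {u. \<forall>v\<in>\<sigma>. v u \<le> 0}"

text \<open>For a submonoid \<open>\<M>\<close> of \<open>M\<close>, the monoid semiring \<open>S[\<M>]\<close> consists of the finitely
  supported functions on \<open>M\<close> with support in \<open>\<M>\<close> and values in \<open>S\<close>; the product of
  the type of finitely supported functions is convolution.\<close>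

definition monoid_semiring :: "trop set \<Rightarrow> 'm::ab_group_add set \<Rightarrow> ('m \<Rightarrow>\<^sub>0 trop) ring" where
  "monoid_semiring S \<M> =
     \<lparr>carrier = {f. Poly_Mapping.keys f \<subseteq> \<M> \<and> (\<forall>u. Poly_Mapping.lookup f u \<in> S)},
      mult = (*), one = 1, zero = 0, add = (+)\<rparr>"

lemma semiring_monoid_semiring:
  fixes \<M> :: "'m::ab_group_add set"
  assumes S: "sub_semifield S" and M: "0 \<in> \<M>" "\<And>u w. u \<in> \<M> \<Longrightarrow> w \<in> \<M> \<Longrightarrow> u + w \<in> \<M>"
  shows "semiring (monoid_semiring S \<M>)"
proof -
  have S0: "0 \<in> S" and S1: "1 \<in> S"
    and Sadd: "a \<in> S \<Longrightarrow> b \<in> S \<Longrightarrow> a + b \<in> S" and Smult: "a \<in> S \<Longrightarrow> b \<in> S \<Longrightarrow> a * b \<in> S" for a b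
    using S by (auto simp: sub_semifield_def)
  have Ssum: "finite A \<Longrightarrow> (\<And>a. a \<in> A \<Longrightarrow> h a \<in> S) \<Longrightarrow> sum h A \<in> S" for h and A :: "'m set"
    by (induction A rule: finite_induct) (auto simp: S0 Sadd)
  have Sany: "(\<And>a. h a \<in> S) \<Longrightarrow> Sum_any h \<in> S" for h :: "'m \<Rightarrow> trop"
    unfolding Sum_any.expand_set by (cases "finite {a. h a \<noteq> 0}") (auto intro: Ssum simp: S0)
  have mult_closed: "Poly_Mapping.lookup (f * g) u \<in> S"
    if "\<And>u. Poly_Mapping.lookup f u \<in> S" "\<And>u. Poly_Mapping.lookup g u \<in> S" for f g :: "'m \<Rightarrow>\<^sub>0 trop" and u
    unfolding times_poly_mapping.rep_eq prod_fun_def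
    by (intro Sany Smult that) (auto simp: when_def S0 that)
  have keys_mult': "Poly_Mapping.keys (f * g) \<subseteq> \<M>"
    if "Poly_Mapping.keys f \<subseteq> \<M>" "Poly_Mapping.keys g \<subseteq> \<M>" for f g :: "'m \<Rightarrow>\<^sub>0 trop"
    using Poly_Mapping.keys_mult[of f g] M(2) that by blast
  have keys_add': "Poly_Mapping.keys (f + g) \<subseteq> \<M>"
    if "Poly_Mapping.keys f \<subseteq> \<M>" "Poly_Mapping.keys g \<subseteq> \<M>" for f g :: "'m \<Rightarrow>\<^sub>0 trop"
    using Poly_Mapping.keys_add[of f g] that by blast
  have keys_1: "Poly_Mapping.keys (1 :: 'm \<Rightarrow>\<^sub>0 trop) \<subseteq> \<M>"
    using M(1) by simp
  have closed: "f + g \<in> carrier (monoid_semiring S \<M>)" "f * g \<in> carrier (monoid_semiring S \<M>)"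
    if "f \<in> carrier (monoid_semiring S \<M>)" "g \<in> carrier (monoid_semiring S \<M>)" for f g
    using that keys_mult' keys_add' mult_closed
    by (simp_all add: monoid_semiring_def Poly_Mapping.lookup_add Sadd)
  show ?thesis
    using closed keys_1
    by (intro semiring.intro abelian_monoidI Group.monoidI semiring_axioms.intro)
      (simp_all add: monoid_semiring_def S0 S1 Poly_Mapping.lookup_one when_def algebra_simps)
qed

section \<open>Tropical vanishing sets\<close>

text \<open>The topology of \<open>\<real> \<union> {-\<infinity>}\<close> is transported from \<open>[0, \<infinity>)\<close> along the exponential.\<close>

definition exp_ext :: "ereal \<Rightarrow> real" where
  "exp_ext x = (if x = -\<infinity> then 0 else exp (real_of_ereal x))"

definition rneginf_top :: "ereal topology" where
  "rneginf_top = pullback_topology {x. x \<noteq> \<infinity>} exp_ext (top_of_set {0::real..})"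

text \<open>\<open>N_tor \<sigma>\<close> is the partial compactification \<open>N\<^sub>\<real>(\<sigma>)\<close>. Its elements are homomorphisms on
  the toric monoid only, so they are represented by functions which are \<open>undefined\<close> elsewhere.\<close>

definition N_tor :: "('m::ab_group_add \<Rightarrow> real) set \<Rightarrow> ('m \<Rightarrow> ereal) set" where
  "N_tor \<sigma> = {x \<in> toric_monoid \<sigma> \<rightarrow>\<^sub>E {t. t \<noteq> \<infinity>}.
     x 0 = 0 \<and> (\<forall>u\<in>toric_monoid \<sigma>. \<forall>w\<in>toric_monoid \<sigma>. x (u + w) = x u + x w)}"

definition N_tor_top :: "('m::ab_group_add \<Rightarrow> real) set \<Rightarrow> ('m \<Rightarrow> ereal) topology" where
  "N_tor_top \<sigma> = subtopology (product_topology (\<lambda>_. rneginf_top) (toric_monoid \<sigma>)) (N_tor \<sigma>)"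

text \<open>The image of \<open>N_space\<close> in \<open>N_tor \<sigma>\<close>.\<close>

definition N_fin :: "('m::ab_group_add \<Rightarrow> real) set \<Rightarrow> ('m \<Rightarrow> ereal) set" where
  "N_fin \<sigma> = {x \<in> N_tor \<sigma>. \<forall>u\<in>toric_monoid \<sigma>. x u \<noteq> -\<infinity>}"

definition tilde :: "('m::ab_group_add \<Rightarrow>\<^sub>0 trop) \<Rightarrow> real \<times> ('m \<Rightarrow> ereal) \<Rightarrow> ereal" where
  "tilde f = (\<lambda>(r, x). if f = 0 then -\<infinity>
     else Max ((\<lambda>u. ereal r * trop_log (Poly_Mapping.lookup f u) + x u) ` Poly_Mapping.keys f))"

definition V_tilde :: "('m::ab_group_add \<Rightarrow> real) set \<Rightarrow>
    (('m \<Rightarrow>\<^sub>0 trop) \<times> ('m \<Rightarrow>\<^sub>0 trop)) set \<Rightarrow> (real \<times> ('m \<Rightarrow> ereal)) set" where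
  "V_tilde \<sigma> E = {w \<in> {0..} \<times> N_tor \<sigma>. \<forall>(f, g)\<in>E. tilde f w = tilde g w}"

definition finite_tropical_basis :: "('m::ab_group_add \<Rightarrow> real) set \<Rightarrow>
    (('m \<Rightarrow>\<^sub>0 trop) \<times> ('m \<Rightarrow>\<^sub>0 trop)) set \<Rightarrow> bool" where
  "finite_tropical_basis \<sigma> E \<longleftrightarrow> (\<exists>F. finite F \<and> F \<subseteq> E \<and> V_tilde \<sigma> E = V_tilde \<sigma> F)"

lemma topspace_N_tor_top: "topspace (N_tor_top \<sigma>) = N_tor \<sigma>"
proof -
  have "topspace rneginf_top = {x. x \<noteq> \<infinity>}"
    by (auto simp: rneginf_top_def topspace_pullback_topology exp_ext_def)
  then show ?thesis
    by (auto simp: N_tor_top_def N_tor_def topspace_subtopology)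
qed

end

theory Submission
  imports Defs
begin

text \<open>
  Every point \<open>w = (r, x)\<close> with finite coordinates defines a prime congruence of \<open>S[\<M>]\<close>, namely
  \<open>{(f, g). tilde f w = tilde g w}\<close>, and its ideal-kernel is trivial because a nonzero polynomial has a
  finite value at \<open>w\<close>. It contains \<open>E\<close> when \<open>w\<close> lies on \<open>V_tilde \<sigma> E\<close>. The theorem holds because every prime \<open>P\<close>
  above \<open>E\<close> contains a limit of primes of this kind; a minimal prime must then be equal to such a limit.

  \<^item> Limits are taken along ultrafilters. For an ultrafilter \<open>U\<close> on the finite points of \<open>V_tilde \<sigma> E\<close>, the pairs
    \<open>(f, g)\<close> with \<open>tilde f = tilde g\<close> eventually along \<open>U\<close> form a prime congruence that contains \<open>E\<close> and has a
    trivial ideal-kernel (\<open>prime_ultra_congruence\<close>, \<open>tilde_finite\<close>). It is contained in \<open>P\<close> as soon as \<open>U\<close>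
    contains the set \<open>{w. tilde f w \<noteq> tilde g w}\<close> for every pair \<open>(f, g)\<close> outside \<open>P\<close>. Such a \<open>U\<close> exists if
    any finitely many of these sets have a common finite point on \<open>V_tilde \<sigma> E\<close>.

  \<^item> That common point is found in two steps (\<open>separate_at_finite_point\<close>). First, finitely many polynomials
    cannot distinguish \<open>P\<close> from a point of the partial compactification: there is a \<open>w\<close>, possibly with infinite
    coordinates, such that \<open>(f, g) \<in> P\<close> is equivalent to \<open>tilde f w = tilde g w\<close> for all \<open>f\<close>, \<open>g\<close> among them
    (\<open>realize_prime\<close>). Applied to a finite tropical basis of \<open>E\<close> together with the given pairs outside \<open>P\<close>,
    this gives a point of \<open>V_tilde \<sigma> E\<close> where the given pairs are separated. Secondly, being separated is
    an open condition, since evaluation is continuous, and by assumption the finite points are dense in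
    \<open>V_tilde \<sigma> E\<close>; hence the pairs are also separated at a finite point.

  \<^item> The point \<open>w\<close> of the first step has the coordinate \<open>-\<infinity>\<close> exactly at the exponents whose monomial is congruent
    to \<open>0\<close>. On the remaining terms \<open>P\<close> induces a total preorder compatible with multiplication, and one needs
    \<open>r \<ge> 0\<close> and a linear form \<open>v\<close> on \<open>M\<close> such that \<open>r log c + v u\<close> orders finitely many given terms \<open>c \<chi>\<^sup>u\<close>
    in the same way. This is a finite system of strict and weak linear inequalities, and Fourier-Motzkin
    elimination solves it (\<open>half_spaces.separation\<close>): the elimination only multiplies terms, so that all derived
    inequalities still hold in the preorder, and finally compares constants, whose order \<open>P\<close> respects.
\<close>

section \<open>Ultrafilters\<close>

definition ultra :: "'a filter \<Rightarrow> bool" where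
  "ultra U \<longleftrightarrow> U \<noteq> bot \<and> (\<forall>P. eventually P U \<or> eventually (\<lambda>x. \<not> P x) U)"

lemma ultra_eventually_not: "ultra U \<Longrightarrow> eventually (\<lambda>x. \<not> P x) U \<longleftrightarrow> \<not> eventually P U"
  unfolding ultra_def using eventually_happens'[of U "\<lambda>x. P x \<and> \<not> P x"]
  by (auto dest: eventually_conj)

lemma ultra_eventually_disj:
  assumes "ultra U"
  shows "eventually (\<lambda>x. P x \<or> Q x) U \<longleftrightarrow> eventually P U \<or> eventually Q U"
  using ultra_eventually_not[OF assms, of "\<lambda>x. P x \<or> Q x"]
    ultra_eventually_not[OF assms, of P] ultra_eventually_not[OF assms, of Q]
  by (auto simp: eventually_conj_iff)

text \<open>A contradiction derived from the infimum of a chain already follows from a single member.\<close>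

lemma chain_of_filters_not_bot:
  assumes "X \<noteq> {}" "\<And>G. G \<in> X \<Longrightarrow> G \<noteq> bot" "\<And>G H. G \<in> X \<Longrightarrow> H \<in> X \<Longrightarrow> G \<le> H \<or> H \<le> G"
  shows "Inf X \<noteq> (bot :: 'a filter)"
proof -
  have "eventually (\<lambda>_. False) (Inf X) \<longleftrightarrow> (\<exists>G\<in>X. eventually (\<lambda>_. False) G)"
  proof (rule eventually_Inf_base)
    fix G H assume "G \<in> X" "H \<in> X"
    then show "\<exists>K\<in>X. K \<le> inf G H"
      using assms(3)[of G H] by (metis inf.absorb1 inf.absorb2 order.refl)
  qed (rule assms(1))
  then show ?thesis
    using assms(2) by (auto simp: trivial_limit_def)
qed

text \<open>By Zorn there is a minimal proper filter \<open>U\<close> below \<open>F\<close>. It decides every predicate \<open>P\<close>: if \<open>U\<close> does not refute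
  \<open>P\<close>, restricting \<open>U\<close> to \<open>P\<close> gives a proper filter, which is \<open>U\<close> itself by minimality.\<close>

lemma ultra_exists:
  assumes "F \<noteq> (bot :: 'a filter)"
  shows "\<exists>U\<le>F. ultra U"
proof -
  define A where "A = {G. G \<noteq> bot \<and> G \<le> F}"
  define rel where "rel = (\<lambda>G H :: 'a filter. H \<le> G)"
  have "\<exists>U\<in>A. \<forall>G\<in>A. rel U G \<longrightarrow> G = U"
  proof (rule predicate_Zorn)
    show "partial_order_on A (relation_of rel A)"
      by (rule partial_order_on_relation_ofI) (auto simp: rel_def)
  next
    fix C assume C: "C \<in> Chains (relation_of rel A)"
    then have CA: "C \<subseteq> A" and ch: "\<And>G H. G \<in> C \<Longrightarrow> H \<in> C \<Longrightarrow> G \<le> H \<or> H \<le> G"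
      by (auto simp: Chains_def relation_of_def rel_def)
    have "Inf (insert F C) \<noteq> bot"
      by (rule chain_of_filters_not_bot) (use assms CA ch in \<open>auto simp: A_def\<close>)
    then show "\<exists>U\<in>A. \<forall>G\<in>C. rel G U"
      by (intro bexI[of _ "Inf (insert F C)"]) (auto simp: A_def rel_def intro: Inf_lower le_infI2)
  qed
  then obtain U where U: "U \<noteq> bot" "U \<le> F"
    and max: "\<And>G. G \<noteq> bot \<Longrightarrow> G \<le> U \<Longrightarrow> G = U"
    unfolding A_def rel_def by (metis (mono_tags, lifting) mem_Collect_eq order.trans)
  have "eventually P U" if "\<not> eventually (\<lambda>x. \<not> P x) U" for P
  proof -
    have "inf U (principal {x. P x}) \<noteq> bot"
      using that by (simp add: trivial_limit_def eventually_inf_principal)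
    then have "inf U (principal {x. P x}) = U"
      by (rule max) simp
    then have "U \<le> principal {x. P x}"
      by (metis inf.cobounded2)
    then show ?thesis
      by (simp add: le_principal)
  qed
  then show ?thesis
    using U by (auto simp: ultra_def)
qed

section \<open>Prime congruences of a semiring and of its quotients\<close>

text \<open>Elementwise form of primality, which avoids computing with the classes of the quotient.\<close>

lemma prime_congruence_iff:
  assumes R: "semiring R" and P: "congruence R P"
  shows "prime_congruence R P \<longleftrightarrow> P \<noteq> carrier R \<times> carrier R \<and>
    (\<forall>a\<in>carrier R. \<forall>b\<in>carrier R. (a \<oplus>\<^bsub>R\<^esub> b, b) \<in> P \<or> (b \<oplus>\<^bsub>R\<^esub> a, a) \<in> P) \<and>
    (\<forall>a\<in>carrier R. (a, \<zero>\<^bsub>R\<^esub>) \<notin> P \<longrightarrow> (\<forall>b\<in>carrier R. \<forall>c\<in>carrier R.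
       (a \<otimes>\<^bsub>R\<^esub> b, a \<otimes>\<^bsub>R\<^esub> c) \<in> P \<longrightarrow> (b, c) \<in> P))"
proof -
  interpret semiring R by fact
  note ops = quot_semiring_class_ops[OF P]
  note eq = eq_equiv_class_iff[OF congruenceD(1)[OF P]]
  have car: "carrier (quot_semiring R P) = (\<lambda>a. P `` {a}) ` carrier R"
    by (auto simp: quot_semiring_def quotient_def)
  have zero: "\<zero>\<^bsub>quot_semiring R P\<^esub> = P `` {\<zero>\<^bsub>R\<^esub>}"
    by (simp add: quot_semiring_def)
  show ?thesis
    using P
    by (simp add: prime_congruence_def proper_congruence_def totally_ordered_semiring_def
        cancellative_semiring_def semiring_le_def car zero ops eq)
qed

definition pull_congruence :: "('a, 'b) ring_scheme \<Rightarrow> ('a \<times> 'a) set \<Rightarrow> ('a set \<times> 'a set) set \<Rightarrow> ('a \<times> 'a) set" where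
  "pull_congruence R E P = {(a, b) \<in> carrier R \<times> carrier R. (E `` {a}, E `` {b}) \<in> P}"

definition push_congruence :: "('a \<times> 'a) set \<Rightarrow> ('a \<times> 'a) set \<Rightarrow> ('a set \<times> 'a set) set" where
  "push_congruence E Q = (\<lambda>(a, b). (E `` {a}, E `` {b})) ` Q"

locale semiring_with_congruence = semiring R for R (structure) +
  fixes E
  assumes E: "congruence R E"
begin

abbreviation "RE \<equiv> quot_semiring R E"

lemma carrier_quot: "carrier RE = (\<lambda>a. E `` {a}) ` carrier R"
  by (auto simp: quot_semiring_def quotient_def)

lemma zero_quot: "\<zero>\<^bsub>RE\<^esub> = E `` {\<zero>}"
  by (simp add: quot_semiring_def)

lemmas ops = quot_semiring_class_ops[OF E]

lemma E_sub: "E \<subseteq> carrier R \<times> carrier R"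
  using congruenceD(1)[OF E] by (simp add: equiv_def refl_on_def)

lemma class_eq_iff: "a \<in> carrier R \<Longrightarrow> b \<in> carrier R \<Longrightarrow> E `` {a} = E `` {b} \<longleftrightarrow> (a, b) \<in> E"
  using eq_equiv_class_iff[OF congruenceD(1)[OF E]] by blast

lemma congruence_pull:
  assumes P: "congruence RE P"
  shows "congruence R (pull_congruence R E P)"
  unfolding congruence_def
proof (intro conjI allI impI)
  have eq: "equiv ((\<lambda>a. E `` {a}) ` carrier R) P"
    using congruenceD(1)[OF P] by (simp add: carrier_quot)
  show "equiv (carrier R) (pull_congruence R E P)"
  proof (rule equivI)
    show "refl_on (carrier R) (pull_congruence R E P)" "pull_congruence R E P \<subseteq> carrier R \<times> carrier R"
      using eq by (auto simp: pull_congruence_def equiv_def refl_on_def)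
    show "sym (pull_congruence R E P)" "trans (pull_congruence R E P)"
      using eq by (auto simp: pull_congruence_def equiv_def intro!: symI transI dest: symD elim: transE)
  qed
next
  fix a b c d assume "(a, b) \<in> pull_congruence R E P" "(c, d) \<in> pull_congruence R E P"
  then show "(a \<oplus> c, b \<oplus> d) \<in> pull_congruence R E P" "(a \<otimes> c, b \<otimes> d) \<in> pull_congruence R E P"
    using congruenceD(2,3)[OF P] by (auto simp: pull_congruence_def ops[symmetric])
qed

lemma pull_contains:
  assumes P: "congruence RE P"
  shows "E \<subseteq> pull_congruence R E P"
proof
  fix p assume "p \<in> E"
  moreover obtain a b where "p = (a, b)" by (cases p)
  ultimately have *: "p = (a, b)" "a \<in> carrier R" "b \<in> carrier R" "E `` {a} = E `` {b}"
    using E_sub class_eq_iff by auto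
  then show "p \<in> pull_congruence R E P"
    using congruenceD(1)[OF P]
    by (auto simp: pull_congruence_def carrier_quot equiv_def refl_on_def)
qed

lemma prime_pull:
  assumes "prime_congruence RE P"
  shows "prime_congruence R (pull_congruence R E P)"
proof -
  have P: "congruence RE P"
    using assms by (simp add: prime_congruence_def proper_congruence_def)
  have sub: "P \<subseteq> carrier RE \<times> carrier RE"
    using congruenceD(1)[OF P] by (simp add: equiv_def refl_on_def)
  note pr = assms[unfolded prime_congruence_iff[OF semiring_quot_semiring[OF semiring_axioms E] P],
      unfolded carrier_quot]
  have "pull_congruence R E P \<noteq> carrier R \<times> carrier R"
    using pr sub by (auto simp: pull_congruence_def carrier_quot)
  moreover have "(a \<oplus> b, b) \<in> pull_congruence R E P \<or> (b \<oplus> a, a) \<in> pull_congruence R E P"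
    if "a \<in> carrier R" "b \<in> carrier R" for a b
    using pr that by (simp add: pull_congruence_def ops[symmetric])
  moreover have "(b, c) \<in> pull_congruence R E P"
    if "a \<in> carrier R" "(a, \<zero>) \<notin> pull_congruence R E P" "b \<in> carrier R" "c \<in> carrier R"
      "(a \<otimes> b, a \<otimes> c) \<in> pull_congruence R E P" for a b c
  proof -
    have "(E `` {a} \<otimes>\<^bsub>RE\<^esub> E `` {b}, E `` {a} \<otimes>\<^bsub>RE\<^esub> E `` {c}) \<in> P" "(E `` {a}, \<zero>\<^bsub>RE\<^esub>) \<notin> P"
      using that by (auto simp: pull_congruence_def zero_quot ops)
    then have "(E `` {b}, E `` {c}) \<in> P"
      using pr that by blast
    then show ?thesis
      using that by (simp add: pull_congruence_def)
  qed
  ultimately show ?thesis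
    unfolding prime_congruence_iff[OF semiring_axioms congruence_pull[OF P]] by blast
qed

lemma mem_push_iff:
  assumes Q: "congruence R Q" "E \<subseteq> Q" and ab: "a \<in> carrier R" "b \<in> carrier R"
  shows "(E `` {a}, E `` {b}) \<in> push_congruence E Q \<longleftrightarrow> (a, b) \<in> Q"
proof
  assume "(E `` {a}, E `` {b}) \<in> push_congruence E Q"
  then obtain c d where cd: "(c, d) \<in> Q" "E `` {a} = E `` {c}" "E `` {b} = E `` {d}"
    by (auto simp: push_congruence_def)
  have eqQ: "equiv (carrier R) Q"
    by (rule congruenceD(1)[OF Q(1)])
  then have "c \<in> carrier R" "d \<in> carrier R"
    using cd by (auto simp: equiv_def refl_on_def)
  then have "(a, c) \<in> Q" "(b, d) \<in> Q"
    using cd ab Q(2) class_eq_iff by blast+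
  with cd eqQ show "(a, b) \<in> Q"
    by (meson equiv_def symE transE)
qed (auto simp: push_congruence_def)

lemma push_sub:
  assumes "congruence R Q"
  shows "push_congruence E Q \<subseteq> (\<lambda>a. E `` {a}) ` carrier R \<times> (\<lambda>a. E `` {a}) ` carrier R"
  using congruenceD(1)[OF assms] by (auto simp: push_congruence_def equiv_def refl_on_def)

lemma congruence_push:
  assumes Q: "congruence R Q" "E \<subseteq> Q"
  shows "congruence RE (push_congruence E Q)"
  unfolding congruence_def
proof (intro conjI allI impI)
  note mem = mem_push_iff[OF Q]
  have Qe: "equiv (carrier R) Q"
    by (rule congruenceD(1)[OF Q(1)])
  show "equiv (carrier RE) (push_congruence E Q)"
    unfolding carrier_quot
  proof (rule equivI)
    show "push_congruence E Q \<subseteq> (\<lambda>a. E `` {a}) ` carrier R \<times> (\<lambda>a. E `` {a}) ` carrier R"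
      by (rule push_sub[OF Q(1)])
    show "refl_on ((\<lambda>a. E `` {a}) ` carrier R) (push_congruence E Q)"
      using Qe by (auto simp: refl_on_def mem equiv_def)
    show "sym (push_congruence E Q)"
      using Qe by (auto simp: sym_def push_congruence_def equiv_def)
    show "trans (push_congruence E Q)"
    proof (rule transI)
      fix X Y Z assume XYZ: "(X, Y) \<in> push_congruence E Q" "(Y, Z) \<in> push_congruence E Q"
      then obtain a b c where "X = E `` {a}" "Y = E `` {b}" "Z = E `` {c}"
        "a \<in> carrier R" "b \<in> carrier R" "c \<in> carrier R"
        using push_sub[OF Q(1)] by blast
      with XYZ show "(X, Z) \<in> push_congruence E Q"
        using Qe by (auto simp: mem equiv_def elim: transE)
    qed
  qed
next
  fix X Y Z W assume XY: "(X, Y) \<in> push_congruence E Q" "(Z, W) \<in> push_congruence E Q"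
  then obtain a b c d where "X = E `` {a}" "Y = E `` {b}" "Z = E `` {c}" "W = E `` {d}"
    "a \<in> carrier R" "b \<in> carrier R" "c \<in> carrier R" "d \<in> carrier R"
    using push_sub[OF Q(1)] by blast
  with XY show "(X \<oplus>\<^bsub>RE\<^esub> Z, Y \<oplus>\<^bsub>RE\<^esub> W) \<in> push_congruence E Q"
    "(X \<otimes>\<^bsub>RE\<^esub> Z, Y \<otimes>\<^bsub>RE\<^esub> W) \<in> push_congruence E Q"
    by (simp_all add: ops mem_push_iff[OF Q] congruenceD(2,3)[OF Q(1)])
qed

lemma prime_push:
  assumes "prime_congruence R Q" "E \<subseteq> Q"
  shows "prime_congruence RE (push_congruence E Q)"
proof -
  have Q: "congruence R Q"
    using assms by (simp add: prime_congruence_def proper_congruence_def)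
  note pr = assms(1)[unfolded prime_congruence_iff[OF semiring_axioms Q]]
  have Qs: "Q \<subseteq> carrier R \<times> carrier R"
    using congruenceD(1)[OF Q] by (simp add: equiv_def refl_on_def)
  note mem = mem_push_iff[OF Q assms(2)]
  obtain a b where "a \<in> carrier R" "b \<in> carrier R" "(a, b) \<notin> Q"
    using pr Qs by blast
  then have "push_congruence E Q \<noteq> carrier RE \<times> carrier RE"
    unfolding carrier_quot using mem by blast
  moreover have "(X \<oplus>\<^bsub>RE\<^esub> Y, Y) \<in> push_congruence E Q \<or> (Y \<oplus>\<^bsub>RE\<^esub> X, X) \<in> push_congruence E Q"
    if "X \<in> carrier RE" "Y \<in> carrier RE" for X Y
  proof -
    obtain a b where "a \<in> carrier R" "X = E `` {a}" "b \<in> carrier R" "Y = E `` {b}"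
      using \<open>X \<in> carrier RE\<close> \<open>Y \<in> carrier RE\<close> unfolding carrier_quot by blast
    moreover from calculation have "(a \<oplus> b, b) \<in> Q \<or> (b \<oplus> a, a) \<in> Q"
      using pr by blast
    ultimately show ?thesis
      by (simp add: ops mem)
  qed
  moreover have "(Y, Z) \<in> push_congruence E Q"
    if "X \<in> carrier RE" "(X, \<zero>\<^bsub>RE\<^esub>) \<notin> push_congruence E Q" "Y \<in> carrier RE" "Z \<in> carrier RE"
      "(X \<otimes>\<^bsub>RE\<^esub> Y, X \<otimes>\<^bsub>RE\<^esub> Z) \<in> push_congruence E Q" for X Y Z
  proof -
    obtain a b c where abc: "a \<in> carrier R" "b \<in> carrier R" "c \<in> carrier R"
      "X = E `` {a}" "Y = E `` {b}" "Z = E `` {c}"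
      using \<open>X \<in> carrier RE\<close> \<open>Y \<in> carrier RE\<close> \<open>Z \<in> carrier RE\<close> unfolding carrier_quot by blast
    then have "(a, \<zero>) \<notin> Q" "(a \<otimes> b, a \<otimes> c) \<in> Q"
      using \<open>(X, _) \<notin> _\<close> \<open>(X \<otimes>\<^bsub>RE\<^esub> Y, _) \<in> _\<close> by (simp_all add: ops mem zero_quot)
    then have "(b, c) \<in> Q"
      using pr abc by blast
    then show ?thesis
      using abc by (simp add: mem)
  qed
  ultimately show ?thesis
    unfolding prime_congruence_iff[OF semiring_quot_semiring[OF semiring_axioms E]
          congruence_push[OF Q assms(2)]] by blast
qed

lemma push_subset:
  assumes "Q \<subseteq> pull_congruence R E P"
  shows "push_congruence E Q \<subseteq> P"
  using assms by (auto simp: pull_congruence_def push_congruence_def)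

text \<open>Primes of the quotient by \<open>E\<close> correspond to primes of \<open>R\<close> above \<open>E\<close>. By minimality, a prime between \<open>E\<close>
  and the preimage of \<open>P\<close> must have \<open>P\<close> as its image, and so \<open>P\<close> inherits its trivial kernel.\<close>

lemma ideal_kernel_minimal_prime:
  assumes P: "minimal_prime_congruence RE P"
    and Q: "prime_congruence R Q" "E \<subseteq> Q" "Q \<subseteq> pull_congruence R E P"
    and ker: "\<And>a. (a, \<zero>) \<in> Q \<Longrightarrow> a = \<zero>"
  shows "ideal_kernel RE P = {\<zero>\<^bsub>RE\<^esub>}"
proof -
  have Qc: "congruence R Q"
    using Q by (simp add: prime_congruence_def proper_congruence_def)
  have "P = push_congruence E Q"
    using P prime_push[OF Q(1,2)] push_subset[OF Q(3)] unfolding minimal_prime_congruence_def by blast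
  moreover have "(\<zero>, \<zero>) \<in> Q"
    using congruenceD(1)[OF Qc] by (simp add: equiv_def refl_on_def)
  moreover have "(E `` {a}, E `` {\<zero>}) \<in> push_congruence E Q \<longleftrightarrow> (a, \<zero>) \<in> Q" if "a \<in> carrier R" for a
    using mem_push_iff[OF Qc Q(2) that zero_closed] .
  ultimately have "X \<in> ideal_kernel RE P \<longleftrightarrow> X = E `` {\<zero>}" for X
    using ker unfolding ideal_kernel_def carrier_quot zero_quot by blast
  then show ?thesis
    unfolding zero_quot by blast
qed

end

section \<open>Separation by Fourier-Motzkin elimination\<close>

text \<open>The elimination step: a variable bounded below by the \<open>l i\<close> and above by the \<open>u j\<close>, strictly for the indices
  in \<open>P\<close> and \<open>Q\<close>. The midpoint of the largest lower and the smallest upper bound satisfies all constraints: it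
  meets a strict bound with equality only if the two bounds coincide, which a strict constraint excludes.\<close>

lemma sandwich_point:
  fixes l :: "'a \<Rightarrow> real" and u :: "'b \<Rightarrow> real"
  assumes "finite I" "finite J"
    and "\<And>i j. i \<in> I \<Longrightarrow> j \<in> J \<Longrightarrow> l i \<le> u j"
    and strict: "\<And>i j. i \<in> I \<Longrightarrow> j \<in> J \<Longrightarrow> P i \<or> Q j \<Longrightarrow> l i < u j"
  shows "\<exists>t. (\<forall>i\<in>I. l i \<le> t \<and> (P i \<longrightarrow> l i < t)) \<and> (\<forall>j\<in>J. t \<le> u j \<and> (Q j \<longrightarrow> t < u j))"
proof (cases "I = {} \<or> J = {}")
  case True
  define t where "t = (if I = {} then Min (insert 0 (u ` J)) - 1 else Max (l ` I) + 1)"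
  show ?thesis
  proof (intro exI[of _ t] conjI ballI impI)
    show "t < u j" "t \<le> u j" if "j \<in> J" for j
    proof -
      have "t = Min (insert 0 (u ` J)) - 1"
        using True that by (auto simp: t_def)
      moreover have "Min (insert 0 (u ` J)) \<le> u j"
        using assms(2) that by (intro Min_le) auto
      ultimately show "t < u j" "t \<le> u j" by auto
    qed
    show "l i < t" "l i \<le> t" if "i \<in> I" for i
    proof -
      have "t = Max (l ` I) + 1"
        using that by (auto simp: t_def)
      moreover have "l i \<le> Max (l ` I)"
        using assms(1) that by (intro Max_ge) auto
      ultimately show "l i < t" "l i \<le> t" by auto
    qed
  qed
next
  case False
  obtain i0 where i0: "i0 \<in> I" "\<And>i. i \<in> I \<Longrightarrow> l i \<le> l i0"
    using False assms(1) obtains_MAX[of I l] by (metis finite_imageI Max_ge imageI)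
  obtain j0 where j0: "j0 \<in> J" "\<And>j. j \<in> J \<Longrightarrow> u j0 \<le> u j"
    using False assms(2) obtains_MIN[of J u] by (metis finite_imageI Min_le imageI)
  show ?thesis
  proof (intro exI[of _ "(l i0 + u j0) / 2"] conjI ballI impI)
    show "l i \<le> (l i0 + u j0) / 2" if "i \<in> I" for i
      using i0(2)[OF that] assms(3)[OF i0(1) j0(1)] by simp
    show "l i < (l i0 + u j0) / 2" if "i \<in> I" "P i" for i
      using i0(2)[OF that(1)] strict[OF that(1) j0(1)] that by simp
    show "(l i0 + u j0) / 2 \<le> u j" if "j \<in> J" for j
      using j0(2)[OF that] assms(3)[OF i0(1) j0(1)] by simp
    show "(l i0 + u j0) / 2 < u j" if "j \<in> J" "Q j" for j
      using j0(2)[OF that(1)] strict[OF i0(1) that(1)] that by simp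
  qed
qed

text \<open>The positive combination of \<open>p\<close> and \<open>q\<close> that cancels the coordinate \<open>k\<close>, where \<open>k\<close> is positive on \<open>p\<close> and
  negative on \<open>q\<close>. The multiplicities are natural numbers, so that only addition in \<open>\<real> \<times> M\<close> is used.\<close>

definition combine :: "('m::ab_group_add \<Rightarrow> int) \<Rightarrow> real \<times> 'm \<Rightarrow> real \<times> 'm \<Rightarrow> real \<times> 'm" where
  "combine k p q = (\<Sum>i<nat (- k (snd q)). p) + (\<Sum>i<nat (k (snd p)). q)"

lemma additive_sum_const:
  fixes f :: "'a::comm_monoid_add \<Rightarrow> 'b::semiring_1"
  assumes "f 0 = 0" "\<And>x y. f (x + y) = f x + f y"
  shows "f (\<Sum>i<n. x) = of_nat n * f x"
  by (induction n) (simp_all add: assms algebra_simps)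

lemma combine_additive:
  fixes f :: "real \<times> 'm::ab_group_add \<Rightarrow> 'b::ring_1"
  assumes "f 0 = 0" "\<And>x y. f (x + y) = f x + f y" "k (snd p) > 0" "k (snd q) < 0"
  shows "f (combine k p q) = of_int (- k (snd q)) * f p + of_int (k (snd p)) * f q"
  using assms(3,4) additive_sum_const[of f, OF assms(1,2)]
  unfolding combine_def assms(2) by simp

text \<open>A pair \<open>(c, u)\<close> stands for the linear form \<open>(r, v) \<mapsto> r c + v u\<close>. The members of \<open>N\<close> are required to be \<open>\<le> 0\<close>
  and those of \<open>Str\<close> to be \<open>< 0\<close>. Both sets are closed under the additions that Fourier-Motzkin elimination
  performs, and \<open>Str_neg\<close> is the consistency of the constraints that remain when all variables are eliminated.\<close>

locale half_spaces =
  fixes N Str :: "(real \<times> 'm::ab_group_add) set"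
  assumes N_add: "p \<in> N \<Longrightarrow> q \<in> N \<Longrightarrow> p + q \<in> N"
    and Str_add: "p \<in> Str \<Longrightarrow> q \<in> N \<Longrightarrow> p + q \<in> Str"
    and Str_N: "Str \<subseteq> N"
    and Str_neg: "(c, 0) \<in> Str \<Longrightarrow> c < 0"
begin

lemma N_multiple: "p \<in> N \<Longrightarrow> 0 < n \<Longrightarrow> (\<Sum>i<n. p) \<in> N" for n :: nat
proof (induction n)
  case (Suc n)
  then show ?case using N_add by (cases n) auto
qed simp

lemma Str_multiple: "p \<in> Str \<Longrightarrow> 0 < n \<Longrightarrow> (\<Sum>i<n. p) \<in> Str" for n :: nat
proof (induction n)
  case (Suc n)
  then have "p \<in> N" using Str_N by blast
  then show ?case using Suc Str_add by (cases n) auto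
qed simp

lemma combine_N:
  "p \<in> N \<Longrightarrow> q \<in> N \<Longrightarrow> k (snd p) > 0 \<Longrightarrow> k (snd q) < 0 \<Longrightarrow> combine k p q \<in> N"
  unfolding combine_def by (intro N_add N_multiple) auto

lemma combine_Str:
  assumes "p \<in> N" "q \<in> N" "p \<in> Str \<or> q \<in> Str" "k (snd p) > 0" "k (snd q) < 0"
  shows "combine k p q \<in> Str"
  using assms(3)
proof
  assume "p \<in> Str"
  then show ?thesis
    unfolding combine_def using assms by (intro Str_add Str_multiple N_multiple) auto
next
  assume "q \<in> Str"
  then show ?thesis
    unfolding combine_def using assms
    by (subst add.commute) (intro Str_add Str_multiple N_multiple; auto)
qed

text \<open>If \<open>N\<close> contained a positive constant, adding a large multiple of it to \<open>(d, 0)\<close> would produce a positive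
  constant in \<open>Str\<close>.\<close>

lemma constants_alternative:
  assumes "(c, 0) \<in> N" "(d, 0) \<in> Str"
  shows "c \<le> 0"
proof (rule ccontr)
  assume "\<not> c \<le> 0"
  then obtain n :: nat where n: "- d < of_nat n * c"
    using reals_Archimedean3[of c] by auto
  have "(\<Sum>i<n. (c, 0::'m)) = (of_nat n * c, 0)"
    by (induction n) (auto simp: algebra_simps zero_prod_def)
  moreover have "d < 0"
    using Str_neg assms(2) .
  then have "n > 0"
    using n by (cases n) auto
  ultimately have "(d, 0) + (of_nat n * c, 0::'m) \<in> Str"
    using Str_add[OF assms(2) N_multiple[OF assms(1)]] by metis
  then show False
    using Str_neg[of "d + of_nat n * c"] n by simp
qed

text \<open>Fourier-Motzkin elimination, by induction on the set of coordinates that occur in the constraints. When none is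
  left, the constraints are constants: if one of them is strict then all constants are \<open>\<le> 0\<close>, the strict ones
  are \<open>< 0\<close>, and \<open>r = 1\<close> works; otherwise \<open>r = 0\<close> works.\<close>

lemma separation:
  fixes \<kappa> :: "'b \<Rightarrow> 'm \<Rightarrow> int"
  assumes "finite B"
    and inj: "\<And>u. \<forall>b\<in>B. \<kappa> b u = 0 \<Longrightarrow> u = 0"
    and add: "\<And>b u w. \<kappa> b (u + w) = \<kappa> b u + \<kappa> b w"
    and "finite A" "A \<subseteq> N" "C \<subseteq> A" "C \<subseteq> Str"
  shows "\<exists>r\<ge>0. \<exists>x :: 'b \<Rightarrow> real. (\<forall>p\<in>A. r * fst p + (\<Sum>b\<in>B. x b * \<kappa> b (snd p)) \<le> 0) \<and>
    (\<forall>p\<in>C. r * fst p + (\<Sum>b\<in>B. x b * \<kappa> b (snd p)) < 0)"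
proof -
  \<comment> \<open>\<open>B'\<close> are the variables still to be eliminated. The hypothesis on coordinates in \<open>B - B'\<close> survives a
    combination of constraints, whereas injectivity of the coordinates in \<open>B'\<close> on the constraints need not.\<close>
  have "\<exists>r\<ge>0. \<exists>x :: 'b \<Rightarrow> real. (\<forall>p\<in>A. r * fst p + (\<Sum>b\<in>B'. x b * \<kappa> b (snd p)) \<le> 0) \<and>
      (\<forall>p\<in>C. r * fst p + (\<Sum>b\<in>B'. x b * \<kappa> b (snd p)) < 0)"
    if "finite B'" "B' \<subseteq> B" "finite A" "A \<subseteq> N" "C \<subseteq> A" "C \<subseteq> Str"
      "\<And>p b. p \<in> A \<Longrightarrow> b \<in> B - B' \<Longrightarrow> \<kappa> b (snd p) = 0" for B' A C
    using that
  proof (induction B' arbitrary: A C rule: finite_induct)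
    case empty
    then have A0: "snd p = 0" if "p \<in> A" for p
      using that inj by simp
    show ?case
    proof (cases "C = {}")
      case True
      then show ?thesis by (intro exI[of _ 0]) simp
    next
      case False
      then obtain p where p: "p \<in> C" "(fst p, 0) \<in> Str"
        using empty A0 by (metis all_not_in_conv prod.collapse subset_eq)
      have "fst q \<le> 0" if "q \<in> A" for q
        using constants_alternative[of "fst q" "fst p"] p that empty A0
        by (metis prod.collapse subset_eq)
      moreover have "fst q < 0" if "q \<in> C" for q
        using Str_neg[of "fst q"] that empty A0 by (metis prod.collapse subset_eq)
      ultimately show ?thesis
        by (intro exI[of _ 1]) simp
    qed
  next
    case (insert b B')
    \<comment> \<open>Constraints without the coordinate \<open>b\<close> are kept; any two in which it has opposite signs are combined.\<close>
    define k where "k = (\<lambda>p :: real \<times> 'm. \<kappa> b (snd p))"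
    have \<kappa>0: "\<kappa> b' 0 = 0" for b'
      using add[of b' 0 0] by simp
    define pairs where "pairs = {(p, q) \<in> A \<times> A. k p > 0 \<and> k q < 0}"
    define spairs where "spairs = {(p, q) \<in> pairs. p \<in> C \<or> q \<in> C}"
    define comb where "comb = (\<lambda>(p, q). combine (\<kappa> b) p q)"
    define A' where "A' = {p \<in> A. k p = 0} \<union> comb ` pairs"
    define C' where "C' = {p \<in> C. k p = 0} \<union> comb ` spairs"
    have "pairs \<subseteq> A \<times> A"
      by (auto simp: pairs_def)
    then have "finite A'"
      using insert.prems(2) by (auto simp: A'_def dest: finite_subset)
    have "comb pq \<in> N" if "pq \<in> pairs" for pq
      using that combine_N[of "fst pq" "snd pq" "\<kappa> b"] subsetD[OF insert.prems(3)]
      by (auto simp: pairs_def comb_def k_def)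
    then have "A' \<subseteq> N"
      using insert.prems(3) by (auto simp: A'_def)
    have "C' \<subseteq> A'"
      using insert.prems(4) by (auto simp: A'_def C'_def spairs_def)
    have "comb pq \<in> Str" if "pq \<in> spairs" for pq
      using that subsetD[OF insert.prems(3)] subsetD[OF insert.prems(5)]
        combine_Str[of "fst pq" "snd pq" "\<kappa> b"]
      by (auto simp: spairs_def pairs_def comb_def k_def)
    then have "C' \<subseteq> Str"
      using insert.prems(5) by (auto simp: C'_def)
    have kc: "\<kappa> b' (snd (comb (p, q))) = - k q * \<kappa> b' (snd p) + k p * \<kappa> b' (snd q)"
      if "(p, q) \<in> pairs" for b' p q
      using combine_additive[of "\<lambda>p. \<kappa> b' (snd p)" "\<kappa> b" p q] that
      by (auto simp: comb_def pairs_def k_def add \<kappa>0)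
    have "\<kappa> b' (snd p) = 0" if "p \<in> A'" "b' \<in> B - B'" for p b'
    proof (cases "b' = b")
      case True
      then show ?thesis
        using that kc by (auto simp: A'_def k_def)
    next
      case False
      then have "\<kappa> b' (snd p) = 0" if "p \<in> A" for p
        using \<open>b' \<in> B - B'\<close> insert.prems(6) that by auto
      moreover have "p \<in> A \<or> (\<exists>q q'. p = comb (q, q') \<and> (q, q') \<in> pairs \<and> q \<in> A \<and> q' \<in> A)"
        using that by (auto simp: A'_def pairs_def)
      ultimately show ?thesis
        using kc by (metis add_0 mult_zero_right)
    qed
    with \<open>finite A'\<close> \<open>A' \<subseteq> N\<close> \<open>C' \<subseteq> A'\<close> \<open>C' \<subseteq> Str\<close>
    have "\<exists>r\<ge>0. \<exists>x :: 'b \<Rightarrow> real. (\<forall>p\<in>A'. r * fst p + (\<Sum>b\<in>B'. x b * \<kappa> b (snd p)) \<le> 0) \<and>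
        (\<forall>p\<in>C'. r * fst p + (\<Sum>b\<in>B'. x b * \<kappa> b (snd p)) < 0)"
      using insert.IH[of A' C'] insert.prems(1) by blast
    then obtain r :: real and x :: "'b \<Rightarrow> real" where "r \<ge> 0"
      and rx: "\<And>p. p \<in> A' \<Longrightarrow> r * fst p + (\<Sum>b\<in>B'. x b * \<kappa> b (snd p)) \<le> 0"
        "\<And>p. p \<in> C' \<Longrightarrow> r * fst p + (\<Sum>b\<in>B'. x b * \<kappa> b (snd p)) < 0"
      by blast
    \<comment> \<open>The constraints in \<open>I\<close> bound the new variable \<open>t\<close> from below, those in \<open>J\<close> from above.\<close>
    define val where "val = (\<lambda>p. r * fst p + (\<Sum>b\<in>B'. x b * \<kappa> b (snd p)))"
    have val_add: "val (p + q) = val p + val q" for p q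
      by (simp add: val_def add algebra_simps sum.distrib)
    have val0: "val 0 = 0"
      by (simp add: val_def \<kappa>0)
    have val_comb: "val (comb (p, q)) = - k q * val p + k p * val q" if "(p, q) \<in> pairs" for p q
      using combine_additive[of val "\<kappa> b" p q, OF val0 val_add] that
      by (auto simp: comb_def pairs_def k_def)
    define I J where "I = {q \<in> A. k q < 0}" and "J = {p \<in> A. k p > 0}"
    have IJ: "- val p / k p \<ge> val q / - k q" "p \<in> C \<or> q \<in> C \<Longrightarrow> - val p / k p > val q / - k q"
      if "q \<in> I" "p \<in> J" for p q
    proof -
      have k: "k p > 0" "k q < 0" and pq: "(p, q) \<in> pairs"
        using that by (auto simp: I_def J_def pairs_def)
      have "val (comb (p, q)) \<le> 0"
        using rx(1)[of "comb (p, q)"] pq by (auto simp: A'_def val_def)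
      then show "- val p / k p \<ge> val q / - k q"
        using k by (simp add: val_comb[OF pq] field_simps)
      assume "p \<in> C \<or> q \<in> C"
      then have "val (comb (p, q)) < 0"
        using rx(2)[of "comb (p, q)"] pq by (auto simp: C'_def spairs_def val_def)
      then show "- val p / k p > val q / - k q"
        using k by (simp add: val_comb[OF pq] field_simps)
    qed
    have "finite I" "finite J"
      using insert.prems(2) by (simp_all add: I_def J_def)
    then have "\<exists>t. (\<forall>q\<in>I. val q / - k q \<le> t \<and> (q \<in> C \<longrightarrow> val q / - k q < t)) \<and>
        (\<forall>p\<in>J. t \<le> - val p / k p \<and> (p \<in> C \<longrightarrow> t < - val p / k p))"
      by (rule sandwich_point) (use IJ in blast)+
    then obtain t where t: "\<And>q. q \<in> I \<Longrightarrow> val q / - k q \<le> t \<and> (q \<in> C \<longrightarrow> val q / - k q < t)"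
      "\<And>p. p \<in> J \<Longrightarrow> t \<le> - val p / k p \<and> (p \<in> C \<longrightarrow> t < - val p / k p)"
      by blast
    have val': "r * fst p + (\<Sum>b'\<in>insert b B'. (x(b := t)) b' * \<kappa> b' (snd p)) = val p + t * k p" for p
    proof -
      have "(\<Sum>b'\<in>B'. (x(b := t)) b' * \<kappa> b' (snd p)) = (\<Sum>b'\<in>B'. x b' * \<kappa> b' (snd p))"
        using \<open>b \<notin> B'\<close> by (intro sum.cong) auto
      then show ?thesis
        using insert.hyps by (simp add: val_def k_def)
    qed
    have "val p + t * k p \<le> 0 \<and> (p \<in> C \<longrightarrow> val p + t * k p < 0)" if "p \<in> A" for p
    proof (cases "k p" "0 :: int" rule: linorder_cases)
      case less
      then show ?thesis
        using t(1)[of p] that by (auto simp: I_def field_simps)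
    next
      case equal
      then show ?thesis
        using rx[of p] that by (auto simp: A'_def C'_def val_def)
    next
      case greater
      then show ?thesis
        using t(2)[of p] that by (auto simp: J_def field_simps)
    qed
    then show ?case
      using \<open>r \<ge> 0\<close> insert.prems(4) unfolding val'[symmetric] by blast
  qed
  from this[OF assms(1) order.refl assms(4-7)] show ?thesis by simp
qed

end

section \<open>Evaluation of polynomials at points\<close>

lemma trop_log_simps [simp]:
  "trop_log 0 = -\<infinity>" "trop_log 1 = 0" "trop_log (a + b) = max (trop_log a) (trop_log b)"
  "trop_log (a * b) = trop_log a + trop_log b"
  by (simp_all add: zero_trop.rep_eq one_trop.rep_eq plus_trop.rep_eq times_trop.rep_eq)

lemma trop_log_not_PInf [simp]: "trop_log a \<noteq> \<infinity>"
  using trop_log[of a] by simp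

lemma trop_log_MInf_iff [simp]: "trop_log a = -\<infinity> \<longleftrightarrow> a = 0"
  by (metis trop_log_inject trop_log_simps(1))

lemma trop_log_real: "a \<noteq> 0 \<Longrightarrow> ereal (real_of_ereal (trop_log a)) = trop_log a"
  by (cases "trop_log a") simp_all

lemma trop_add_idem [simp]: "a + a = (a :: trop)"
  by (simp flip: trop_log_inject)

lemma trop_add_eq_0_iff [simp]: "a + b = 0 \<longleftrightarrow> a = 0 \<and> b = (0 :: trop)"
proof -
  have "max (trop_log a) (trop_log b) = -\<infinity> \<longleftrightarrow> trop_log a = -\<infinity> \<and> trop_log b = -\<infinity>"
    by (auto simp: max_def)
  then show ?thesis
    unfolding trop_log_simps(3)[symmetric] trop_log_MInf_iff .
qed

lemma trop_mult_eq_0_iff [simp]: "a * b = 0 \<longleftrightarrow> a = 0 \<or> b = (0 :: trop)"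
proof -
  have "trop_log a + trop_log b = -\<infinity> \<longleftrightarrow> trop_log a = -\<infinity> \<or> trop_log b = -\<infinity>"
    by (cases "trop_log a"; cases "trop_log b") (use trop_log_not_PInf in auto)
  then show ?thesis
    unfolding trop_log_simps(4)[symmetric] trop_log_MInf_iff .
qed

lemma poly_add_idem [simp]: "f + f = (f :: 'm \<Rightarrow>\<^sub>0 trop)"
  by (rule poly_mapping_eqI) (simp add: lookup_add)

lemma toric_monoid_closed:
  assumes "rational_polyhedral_cone \<sigma>"
  shows "0 \<in> toric_monoid \<sigma>" "u \<in> toric_monoid \<sigma> \<Longrightarrow> w \<in> toric_monoid \<sigma> \<Longrightarrow> u + w \<in> toric_monoid \<sigma>"
proof -
  have add: "v (u + w) = v u + v w" if "v \<in> \<sigma>" for v u w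
  proof -
    obtain G where G: "G \<subseteq> N_lattice" and "\<sigma> = cone_generated G"
      using assms unfolding rational_polyhedral_cone_def by blast
    then obtain c where v: "v = (\<lambda>u. \<Sum>g\<in>G. c g * g u)"
      using \<open>v \<in> \<sigma>\<close> unfolding cone_generated_def by auto
    have "c g * g (u + w) = c g * g u + c g * g w" if "g \<in> G" for g
      using G that by (auto simp: N_lattice_def N_space_def distrib_left)
    then show ?thesis
      unfolding v sum.distrib[symmetric] by (rule sum.cong[OF refl])
  qed
  have "v 0 = 0" if "v \<in> \<sigma>" for v
    using add[OF that, of 0 0] by simp
  then show "0 \<in> toric_monoid \<sigma>"
    unfolding toric_monoid_def by force
  show "u + w \<in> toric_monoid \<sigma>" if "u \<in> toric_monoid \<sigma>" "w \<in> toric_monoid \<sigma>"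
    unfolding toric_monoid_def
  proof (rule CollectI, rule ballI)
    fix v assume v: "v \<in> \<sigma>"
    then have "v u \<le> 0" "v w \<le> 0"
      using that by (auto simp: toric_monoid_def)
    then show "v (u + w) \<le> 0"
      unfolding add[OF v] by simp
  qed
qed

lemma sum_of_terms:
  fixes f :: "'m \<Rightarrow>\<^sub>0 'a::comm_monoid_add"
  assumes "finite X" "Poly_Mapping.keys f \<subseteq> X"
  shows "(\<Sum>u\<in>X. Poly_Mapping.single u (Poly_Mapping.lookup f u)) = f"
proof (rule poly_mapping_eqI)
  fix w
  have "Poly_Mapping.lookup (\<Sum>u\<in>X. Poly_Mapping.single u (Poly_Mapping.lookup f u)) w
      = (\<Sum>u\<in>X. if u = w then Poly_Mapping.lookup f w else 0)"
    by (auto simp: lookup_sum lookup_single when_def intro!: sum.cong)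
  also have "\<dots> = Poly_Mapping.lookup f w"
    using assms by (auto simp: not_in_keys_iff_lookup_eq_zero subset_iff)
  finally show "Poly_Mapping.lookup (\<Sum>u\<in>X. Poly_Mapping.single u (Poly_Mapping.lookup f u)) w
      = Poly_Mapping.lookup f w" .
qed

text \<open>The value of the term \<open>c \<chi>\<^sup>u\<close> at the point \<open>w\<close>. The zero coefficient needs its own case because for \<open>r = 0\<close> the
  product \<open>r log 0\<close> is \<open>0\<close> in the extended reals.\<close>

definition term_value :: "real \<times> ('m \<Rightarrow> ereal) \<Rightarrow> trop \<Rightarrow> 'm \<Rightarrow> ereal" where
  "term_value w c u = (if c = 0 then -\<infinity> else ereal (fst w) * trop_log c + snd w u)"

lemma term_value_real: "c \<noteq> 0 \<Longrightarrow> term_value w c u = ereal (fst w * real_of_ereal (trop_log c)) + snd w u"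
  unfolding term_value_def by (subst trop_log_real[symmetric]) simp_all

text \<open>Writing the maximum over the support as a supremum over all exponents makes the support disappear from the
  computation with sums.\<close>

lemma tilde_eq_SUP: "tilde f w = (SUP u. term_value w (Poly_Mapping.lookup f u) u)"
proof (cases "f = 0")
  case True
  then show ?thesis
    by (cases w) (simp add: tilde_def term_value_def)
next
  case False
  then have ne: "Poly_Mapping.keys f \<noteq> {}"
    by simp
  let ?t = "\<lambda>u. term_value w (Poly_Mapping.lookup f u) u"
  have "tilde f w = Max (?t ` Poly_Mapping.keys f)"
    using False by (cases w) (auto simp: tilde_def term_value_def in_keys_iff intro!: arg_cong[of _ _ Max] image_cong)
  also have "\<dots> = (SUP u\<in>Poly_Mapping.keys f. ?t u)"
    using ne by (simp add: Max_Sup)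
  also have "\<dots> = (SUP u. ?t u)"
  proof (rule SUP_eq)
    show "\<exists>v\<in>Poly_Mapping.keys f. ?t u \<le> ?t v" for u
    proof (cases "u \<in> Poly_Mapping.keys f")
      case False
      then have "?t u = -\<infinity>"
        by (simp add: not_in_keys_iff_lookup_eq_zero term_value_def)
      moreover obtain v where "v \<in> Poly_Mapping.keys f"
        using ne by blast
      ultimately show ?thesis by auto
    qed blast
  qed auto
  finally show ?thesis .
qed

lemma tilde_zero [simp]: "tilde 0 w = -\<infinity>"
  by (cases w) (simp add: tilde_def)

lemma tilde_single [simp]: "tilde (Poly_Mapping.single u c) w = term_value w c u"
proof (cases "c = 0")
  case True
  then show ?thesis
    by (cases w) (simp add: tilde_def term_value_def)
next
  case False
  then show ?thesis
    by (cases w) (simp add: tilde_def term_value_def flip: keys_eq_empty)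
qed

lemma term_value_add:
  assumes "fst w \<ge> 0"
  shows "term_value w (c + d) u = max (term_value w c u) (term_value w d u)"
proof (cases "c = 0 \<or> d = 0")
  case True
  then show ?thesis
    by (auto simp: term_value_def)
next
  case False
  then have "real_of_ereal (trop_log (c + d)) = max (real_of_ereal (trop_log c)) (real_of_ereal (trop_log d))"
    using trop_log_real[of c] trop_log_real[of d] by (metis ereal_max real_of_ereal.simps(1) trop_log_simps(3))
  moreover have "ereal (max a b) + x = max (ereal a + x) (ereal b + x)" for a b x
    by (cases x) (auto simp: max_def)
  ultimately show ?thesis
    using False assms by (simp add: term_value_real max_mult_distrib_left)
qed

lemma tilde_add:
  assumes "fst w \<ge> 0"
  shows "tilde (f + g) w = max (tilde f w) (tilde g w)"
  using SUP_sup_distrib[of UNIV "\<lambda>u. term_value w (Poly_Mapping.lookup f u) u"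
      "\<lambda>u. term_value w (Poly_Mapping.lookup g u) u"]
  by (simp add: tilde_eq_SUP lookup_add term_value_add[OF assms])

locale toric_semiring =
  fixes \<sigma> :: "('m::ab_group_add \<Rightarrow> real) set" and S :: "trop set"
  assumes \<sigma>: "rational_polyhedral_cone \<sigma>" and S: "sub_semifield S"
begin

abbreviation "M \<equiv> toric_monoid \<sigma>"
abbreviation "SM \<equiv> monoid_semiring S (toric_monoid \<sigma>)"

lemma SM_ops [simp]: "a \<oplus>\<^bsub>SM\<^esub> b = a + b" "a \<otimes>\<^bsub>SM\<^esub> b = a * b" "\<zero>\<^bsub>SM\<^esub> = 0" "\<one>\<^bsub>SM\<^esub> = 1"
  by (simp_all add: monoid_semiring_def)

lemma semiring_SM: "semiring SM"
  by (rule semiring_monoid_semiring[OF S toric_monoid_closed[OF \<sigma>]])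

lemmas SM_closed = semiring.semiring_simprules(1-4)[OF semiring_SM, unfolded SM_ops]

lemma carrier_SM_iff:
  "f \<in> carrier SM \<longleftrightarrow> Poly_Mapping.keys f \<subseteq> M \<and> (\<forall>u. Poly_Mapping.lookup f u \<in> S)"
  by (simp add: monoid_semiring_def)

lemma S0: "0 \<in> S" and S1: "1 \<in> S" and Smult: "c \<in> S \<Longrightarrow> d \<in> S \<Longrightarrow> c * d \<in> S"
  using S by (simp_all add: sub_semifield_def)

lemma single_closed: "u \<in> M \<Longrightarrow> c \<in> S \<Longrightarrow> Poly_Mapping.single u c \<in> carrier SM"
  using S0 by (simp add: carrier_SM_iff lookup_single when_def)

text \<open>Multiplicativity and continuity of evaluation are proved by induction along this rule: they hold for single
  terms, and addition becomes a maximum.\<close>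

lemma SM_induct [consumes 1, case_names zero single add]:
  assumes f: "f \<in> carrier SM" and "P 0"
    and "\<And>u c. u \<in> M \<Longrightarrow> c \<in> S \<Longrightarrow> P (Poly_Mapping.single u c)"
    and "\<And>f g. f \<in> carrier SM \<Longrightarrow> g \<in> carrier SM \<Longrightarrow> P f \<Longrightarrow> P g \<Longrightarrow> P (f + g)"
  shows "P f"
proof -
  let ?s = "\<lambda>X. \<Sum>u\<in>X. Poly_Mapping.single u (Poly_Mapping.lookup f u)"
  have "?s X \<in> carrier SM \<and> P (?s X)" if "finite X" "X \<subseteq> M" for X
    using that
  proof (induction X rule: finite_induct)
    case empty
    then show ?case using assms(2) SM_closed(2) by simp
  next
    case (insert u X)
    have "u \<in> M" "Poly_Mapping.lookup f u \<in> S"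
      using f insert.prems by (auto simp: carrier_SM_iff)
    then have "?s {u} \<in> carrier SM" "P (?s {u})"
      by (simp_all add: single_closed assms(3))
    moreover have "?s X \<in> carrier SM" "P (?s X)"
      using insert by auto
    ultimately have "?s {u} + ?s X \<in> carrier SM" "P (?s {u} + ?s X)"
      by (blast intro: assms(4) SM_closed(1))+
    then show ?case
      using insert.hyps by simp
  qed
  then show ?thesis
    using sum_of_terms[of "Poly_Mapping.keys f" f] f by (metis carrier_SM_iff finite_keys order.refl)
qed

lemma N_tor_facts:
  assumes "w \<in> {0..} \<times> N_tor \<sigma>"
  shows "fst w \<ge> 0" "snd w 0 = 0" "u \<in> M \<Longrightarrow> snd w u \<noteq> \<infinity>"
    "u \<in> M \<Longrightarrow> v \<in> M \<Longrightarrow> snd w (u + v) = snd w u + snd w v"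
proof -
  have x: "snd w \<in> N_tor \<sigma>"
    using assms by auto
  show "fst w \<ge> 0"
    using assms by auto
  show "snd w 0 = 0"
    using x unfolding N_tor_def by blast
  show "snd w u \<noteq> \<infinity>" if "u \<in> M"
    using x that unfolding N_tor_def by (blast dest: PiE_mem)
  show "snd w (u + v) = snd w u + snd w v" if "u \<in> M" "v \<in> M"
    using x that unfolding N_tor_def by blast
qed

lemma tilde_not_PInf:
  assumes "w \<in> {0..} \<times> N_tor \<sigma>" "f \<in> carrier SM"
  shows "tilde f w \<noteq> \<infinity>"
  using assms(2)
proof (induction rule: SM_induct)
  case (single u c)
  then show ?case using N_tor_facts(3)[OF assms(1)] by (auto simp: term_value_real term_value_def)
qed (auto simp: tilde_add[OF N_tor_facts(1)[OF assms(1)]] max_def)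

lemma term_value_mult:
  assumes "w \<in> {0..} \<times> N_tor \<sigma>" "u \<in> M" "v \<in> M"
  shows "term_value w (c * d) (u + v) = term_value w c u + term_value w d v"
proof (cases "c = 0 \<or> d = 0")
  case True
  then show ?thesis
    using N_tor_facts(3)[OF assms(1)] assms(2,3) by (auto simp: term_value_def)
next
  case False
  then obtain a b where "trop_log c = ereal a" "trop_log d = ereal b"
    using trop_log_real by metis
  moreover have "snd w u \<noteq> \<infinity>" "snd w v \<noteq> \<infinity>"
    using N_tor_facts(3)[OF assms(1)] assms(2,3) by auto
  ultimately show ?thesis
    using False N_tor_facts(4)[OF assms]
    by (cases "snd w u"; cases "snd w v") (simp_all add: term_value_def algebra_simps)
qed

lemma tilde_mult:
  assumes w: "w \<in> {0..} \<times> N_tor \<sigma>" and f: "f \<in> carrier SM" and g: "g \<in> carrier SM"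
  shows "tilde (f * g) w = tilde f w + tilde g w"
proof -
  have distrib: "max a b + c = max (a + c) (b + c)" "c + max a b = max (c + a) (c + b)" for a b c :: ereal
    by (auto simp: max_def not_le intro!: antisym intro: add_right_mono add_left_mono less_imp_le)
  have s: "tilde (Poly_Mapping.single u c * g) w = term_value w c u + tilde g w" if "u \<in> M" "c \<in> S" for u c
    using g
  proof (induction rule: SM_induct)
    case zero
    then show ?case
      using tilde_not_PInf[OF w single_closed[OF that]] by simp
  next
    case (single v d)
    then show ?case
      using that by (simp add: mult_single term_value_mult[OF w])
  next
    case (add f g)
    then show ?case
      by (simp add: distrib_left tilde_add[OF N_tor_facts(1)[OF w]] distrib)
  qed
  show ?thesis
    using f
  proof (induction rule: SM_induct)
    case zero
    then show ?case
      using tilde_not_PInf[OF w g] by simp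
  next
    case (single u c)
    then show ?case
      by (simp add: s)
  next
    case (add f g)
    then show ?case
      by (simp add: distrib_right tilde_add[OF N_tor_facts(1)[OF w]] distrib)
  qed
qed

lemma tilde_one: "w \<in> {0..} \<times> N_tor \<sigma> \<Longrightarrow> tilde 1 w = 0"
  using N_tor_facts(2)[of w] by (simp flip: single_one add: term_value_def)

lemma tilde_finite:
  assumes w: "w \<in> {0..} \<times> N_fin \<sigma>" and f: "f \<in> carrier SM" "tilde f w = -\<infinity>"
  shows "f = 0"
proof (rule ccontr)
  assume "f \<noteq> 0"
  then obtain u where u: "u \<in> Poly_Mapping.keys f"
    by (metis all_not_in_conv keys_eq_empty)
  have "term_value w (Poly_Mapping.lookup f u) u \<le> tilde f w"
    unfolding tilde_eq_SUP by (rule SUP_upper) simp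
  moreover have "u \<in> M"
    using u f by (auto simp: carrier_SM_iff)
  ultimately show False
    using w u f by (auto simp: term_value_real in_keys_iff N_fin_def)
qed

section \<open>Continuity of evaluation\<close>

lemma exp_ext_inj: "a \<noteq> \<infinity> \<Longrightarrow> b \<noteq> \<infinity> \<Longrightarrow> exp_ext a = exp_ext b \<longleftrightarrow> a = b"
  by (cases a; cases b) (auto simp: exp_ext_def)

lemma exp_ext_max: "a \<noteq> \<infinity> \<Longrightarrow> b \<noteq> \<infinity> \<Longrightarrow> exp_ext (max a b) = max (exp_ext a) (exp_ext b)"
  by (cases a; cases b) (auto simp: exp_ext_def max_def)

lemma exp_ext_add: "x \<noteq> \<infinity> \<Longrightarrow> exp_ext (ereal a + x) = exp a * exp_ext x"
  by (cases x) (auto simp: exp_ext_def exp_add)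

abbreviation "W_top \<equiv> prod_topology (top_of_set {0::real..}) (N_tor_top \<sigma>)"

lemma continuous_map_exp_coordinate:
  assumes "u \<in> M"
  shows "continuous_map W_top euclideanreal (\<lambda>w. exp_ext (snd w u))"
proof -
  have "continuous_map (N_tor_top \<sigma>) rneginf_top (\<lambda>x. x u)"
    unfolding N_tor_top_def
    by (intro continuous_map_from_subtopology continuous_map_product_projection assms)
  then have "continuous_map W_top rneginf_top (\<lambda>w. snd w u)"
    using continuous_map_compose[OF continuous_map_snd] by (fastforce simp: o_def)
  moreover have "continuous_map rneginf_top euclideanreal (id \<circ> exp_ext)"
    unfolding rneginf_top_def
    by (intro continuous_map_pullback) (simp add: continuous_map_from_subtopology)
  ultimately show ?thesis
    using continuous_map_compose by (fastforce simp: o_def)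
qed

text \<open>On a term \<open>c \<chi>\<^sup>u\<close> the exponential of the value at \<open>(r, x)\<close> is \<open>exp (r log c) \<cdot> exp (x u)\<close>. Both factors are
  continuous: the topology of \<open>\<real> \<union> {-\<infinity>}\<close> is defined by making the exponential continuous.\<close>

lemma continuous_map_exp_tilde:
  assumes "f \<in> carrier SM"
  shows "continuous_map W_top euclideanreal (\<lambda>w. exp_ext (tilde f w))"
proof -
  have W: "topspace W_top = {0..} \<times> N_tor \<sigma>"
    by (simp add: topspace_N_tor_top)
  show ?thesis
    using assms
  proof (induction rule: SM_induct)
    case zero
    then show ?case by simp
  next
    case (single u c)
    show ?case
    proof (cases "c = 0")
      case True
      then show ?thesis by (simp add: term_value_def)
    next
      case False
      have "continuous_map W_top (top_of_set {0..}) fst"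
        by (rule continuous_map_fst)
      then have "continuous_map W_top euclideanreal fst"
        by (simp add: continuous_map_in_subtopology)
      then have "continuous_map W_top euclideanreal (exp \<circ> (\<lambda>w. fst w * real_of_ereal (trop_log c)))"
        by (intro continuous_map_compose[of _ euclideanreal] continuous_map_real_mult)
          (auto simp: continuous_on_exp)
      then have "continuous_map W_top euclideanreal
          (\<lambda>w. (exp \<circ> (\<lambda>w. fst w * real_of_ereal (trop_log c))) w * exp_ext (snd w u))"
        by (intro continuous_map_real_mult continuous_map_exp_coordinate single)
      then show ?thesis
      proof (rule continuous_map_eq)
        fix w assume "w \<in> topspace W_top"
        then show "(exp \<circ> (\<lambda>w. fst w * real_of_ereal (trop_log c))) w * exp_ext (snd w u)
            = exp_ext (tilde (Poly_Mapping.single u c) w)"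
          using False N_tor_facts(3)[of w u] single unfolding W
          by (simp add: term_value_real exp_ext_add)
      qed
    qed
  next
    case (add f g)
    then have "continuous_map W_top euclideanreal (\<lambda>w. max (exp_ext (tilde f w)) (exp_ext (tilde g w)))"
      by (intro continuous_map_real_max)
    then show ?case
    proof (rule continuous_map_eq)
      fix w assume "w \<in> topspace W_top"
      then show "max (exp_ext (tilde f w)) (exp_ext (tilde g w)) = exp_ext (tilde (f + g) w)"
        using add N_tor_facts(1)[of w] tilde_not_PInf[of w] unfolding W
        by (simp add: tilde_add exp_ext_max)
    qed
  qed
qed

lemma openin_tilde_neq:
  assumes "f \<in> carrier SM" "g \<in> carrier SM"
  shows "openin W_top {w \<in> topspace W_top. tilde f w \<noteq> tilde g w}"
proof -
  have "continuous_map W_top euclideanreal (\<lambda>w. exp_ext (tilde f w) - exp_ext (tilde g w))"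
    by (intro continuous_map_diff continuous_map_exp_tilde assms)
  from openin_continuous_map_preimage[OF this, of "- {0}"]
  have "openin W_top {w \<in> topspace W_top. exp_ext (tilde f w) - exp_ext (tilde g w) \<in> - {0}}"
    by (simp add: open_Compl)
  also have "{w \<in> topspace W_top. exp_ext (tilde f w) - exp_ext (tilde g w) \<in> - {0}}
      = {w \<in> topspace W_top. tilde f w \<noteq> tilde g w}"
    using assms by (auto simp: topspace_N_tor_top exp_ext_inj tilde_not_PInf)
  finally show ?thesis .
qed

section \<open>Limits of points are primes\<close>

definition ultra_congruence :: "(real \<times> ('m \<Rightarrow> ereal)) filter \<Rightarrow> (('m \<Rightarrow>\<^sub>0 trop) \<times> ('m \<Rightarrow>\<^sub>0 trop)) set" where
  "ultra_congruence U = {(f, g) \<in> carrier SM \<times> carrier SM. eventually (\<lambda>w. tilde f w = tilde g w) U}"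

text \<open>The quotient is a subsemiring of the ultrapower of \<open>\<real> \<union> {-\<infinity>}\<close> along \<open>U\<close>, which is again totally ordered and
  cancellative.\<close>

lemma prime_ultra_congruence:
  assumes U: "ultra U" and W: "eventually (\<lambda>w. w \<in> {0..} \<times> N_tor \<sigma>) U"
  shows "prime_congruence SM (ultra_congruence U)"
proof -
  let ?Q = "ultra_congruence U"
  have "equiv (carrier SM) ?Q"
    by (rule equivI)
      (auto simp: ultra_congruence_def refl_on_def eq_commute intro!: symI transI elim: eventually_elim2)
  moreover have "(a + c, b + d) \<in> ?Q" "(a * c, b * d) \<in> ?Q" if "(a, b) \<in> ?Q" "(c, d) \<in> ?Q" for a b c d
  proof -
    have *: "a \<in> carrier SM" "b \<in> carrier SM" "c \<in> carrier SM" "d \<in> carrier SM"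
      and ev: "eventually (\<lambda>w. tilde a w = tilde b w \<and> tilde c w = tilde d w \<and> w \<in> {0..} \<times> N_tor \<sigma>) U"
      using that W by (auto simp: ultra_congruence_def eventually_conj_iff)
    have "eventually (\<lambda>w. tilde (a + c) w = tilde (b + d) w) U"
      using ev by eventually_elim (use N_tor_facts(1) in \<open>auto simp: tilde_add\<close>)
    moreover have "eventually (\<lambda>w. tilde (a * c) w = tilde (b * d) w) U"
      using ev by eventually_elim (simp add: tilde_mult *)
    ultimately show "(a + c, b + d) \<in> ?Q" "(a * c, b * d) \<in> ?Q"
      using * SM_closed by (simp_all add: ultra_congruence_def)
  qed
  ultimately have Q: "congruence SM ?Q"
    by (simp add: congruence_def)
  have "eventually (\<lambda>w. tilde 1 w \<noteq> tilde 0 w) U"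
    using W by eventually_elim (simp add: tilde_one)
  then have "(1, 0) \<notin> ?Q"
    using ultra_eventually_not[OF U, of "\<lambda>w. tilde 1 w = tilde 0 w"] by (simp add: ultra_congruence_def)
  then have "?Q \<noteq> carrier SM \<times> carrier SM"
    using SM_closed by auto
  moreover have "(a + b, b) \<in> ?Q \<or> (b + a, a) \<in> ?Q" if "a \<in> carrier SM" "b \<in> carrier SM" for a b
  proof -
    have "eventually (\<lambda>w. tilde (a + b) w = tilde b w \<or> tilde (b + a) w = tilde a w) U"
      using W
    proof eventually_elim
      case (elim w)
      then show ?case
        using tilde_add[OF N_tor_facts(1)[OF elim]] by (auto simp: max_def)
    qed
    then show ?thesis
      using that SM_closed by (simp add: ultra_eventually_disj[OF U] ultra_congruence_def)
  qed
  moreover have "(b, c) \<in> ?Q"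
    if "a \<in> carrier SM" "b \<in> carrier SM" "c \<in> carrier SM" "(a, 0) \<notin> ?Q" "(a * b, a * c) \<in> ?Q" for a b c
  proof -
    have "eventually (\<lambda>w. tilde a w \<noteq> -\<infinity>) U"
      using that SM_closed by (simp add: ultra_congruence_def ultra_eventually_not[OF U])
    moreover have "eventually (\<lambda>w. tilde (a * b) w = tilde (a * c) w) U"
      using that by (simp add: ultra_congruence_def)
    ultimately have "eventually (\<lambda>w. tilde b w = tilde c w) U"
      using W
    proof eventually_elim
      case (elim w)
      then have "tilde a w \<noteq> \<infinity>" "tilde a w + tilde b w = tilde a w + tilde c w"
        using that tilde_not_PInf[of w a] by (simp_all add: tilde_mult)
      with elim(1) show ?case
        by (cases "tilde a w"; cases "tilde b w"; cases "tilde c w") auto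
    qed
    then show ?thesis
      using that by (simp add: ultra_congruence_def)
  qed
  ultimately show ?thesis
    unfolding prime_congruence_iff[OF semiring_SM Q] by simp
qed

end

section \<open>Primes on finitely many polynomials\<close>

text \<open>The coordinates with respect to a basis of \<open>M\<close>.\<close>

lemma integer_coordinates:
  assumes "fg_free_abelian TYPE('m::ab_group_add)"
  obtains B and \<kappa> :: "'m::ab_group_add \<Rightarrow> 'm \<Rightarrow> int" where "finite B"
    "\<And>b u w. \<kappa> b (u + w) = \<kappa> b u + \<kappa> b w" "\<And>u. \<forall>b\<in>B. \<kappa> b u = 0 \<Longrightarrow> u = 0"
proof -
  obtain B :: "'m set" where B: "finite B" "int_mod.independent B" "int_mod.span B = UNIV"
    using assms by (auto simp: fg_free_abelian_def)
  show ?thesis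
  proof (rule that[of B "\<lambda>b u. int_mod.representation B u b"])
    show "u = 0" if "\<forall>b\<in>B. int_mod.representation B u b = 0" for u
      using int_mod.sum_representation_eq[of B u B] B that by simp
  qed (use B in \<open>simp_all add: int_mod.representation_add\<close>)
qed

text \<open>A prime \<open>P\<close> of \<open>S[\<M>]\<close>, studied through the order of the quotient, which is written \<open>le\<close> below.\<close>

locale toric_prime = toric_semiring \<sigma> S
  for \<sigma> :: "('m::ab_group_add \<Rightarrow> real) set" and S :: "trop set" +
  fixes P :: "(('m \<Rightarrow>\<^sub>0 trop) \<times> ('m \<Rightarrow>\<^sub>0 trop)) set"
  assumes fg: "fg_free_abelian TYPE('m)"
    and prime: "prime_congruence SM P"
begin

lemma congruence_P: "congruence SM P"
  using prime by (simp add: prime_congruence_def proper_congruence_def)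

lemma P_sub: "P \<subseteq> carrier SM \<times> carrier SM"
  using congruenceD(1)[OF congruence_P] by (simp add: equiv_def refl_on_def)

lemma P_refl: "f \<in> carrier SM \<Longrightarrow> (f, f) \<in> P"
  and P_sym: "(f, g) \<in> P \<Longrightarrow> (g, f) \<in> P"
  and P_trans: "(f, g) \<in> P \<Longrightarrow> (g, h) \<in> P \<Longrightarrow> (f, h) \<in> P"
  using congruenceD(1)[OF congruence_P] unfolding equiv_def refl_on_def
  by (blast, blast dest: symD, blast dest: transD)

lemma P_add: "(f, g) \<in> P \<Longrightarrow> (f', g') \<in> P \<Longrightarrow> (f + f', g + g') \<in> P"
  and P_mult: "(f, g) \<in> P \<Longrightarrow> (f', g') \<in> P \<Longrightarrow> (f * f', g * g') \<in> P"
  using congruenceD(2,3)[OF congruence_P] by (simp_all add: SM_ops)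

lemmas prime_iff = prime[unfolded prime_congruence_iff[OF semiring_SM congruence_P], unfolded SM_ops]

lemma P_cancel:
  assumes "f \<in> carrier SM" "g \<in> carrier SM" "h \<in> carrier SM" "(f, 0) \<notin> P" "(f * g, f * h) \<in> P"
  shows "(g, h) \<in> P"
  using prime_iff assms by blast

lemma one_not_zero: "(1, 0) \<notin> P"
proof
  assume "(1, 0) \<in> P"
  then have "(f, 0) \<in> P" if "f \<in> carrier SM" for f
    using P_mult[OF P_refl[OF that]] by fastforce
  then have "P = carrier SM \<times> carrier SM"
    using P_sub P_trans P_sym by blast
  then show False
    using prime_iff by blast
qed

definition le where "le f g \<longleftrightarrow> (f + g, g) \<in> P"

lemma le_total: "f \<in> carrier SM \<Longrightarrow> g \<in> carrier SM \<Longrightarrow> le f g \<or> le g f"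
  using prime_iff unfolding le_def by blast

lemma le_refl: "f \<in> carrier SM \<Longrightarrow> le f f"
  by (simp add: le_def P_refl)

lemma le_trans:
  assumes "f \<in> carrier SM" "h \<in> carrier SM" "le f g" "le g h"
  shows "le f h"
proof -
  have "(f + h, f + (g + h)) \<in> P"
    using P_add[OF P_refl[OF assms(1)] P_sym] assms(4) by (simp add: le_def)
  moreover have "(f + g + h, g + h) \<in> P"
    using P_add[OF _ P_refl[OF assms(2)]] assms(3) by (simp add: le_def)
  moreover have "(g + h, h) \<in> P"
    using assms(4) by (simp add: le_def)
  ultimately show ?thesis
    unfolding le_def add.assoc by (meson P_trans)
qed

lemma P_iff_le: "f \<in> carrier SM \<Longrightarrow> g \<in> carrier SM \<Longrightarrow> (f, g) \<in> P \<longleftrightarrow> le f g \<and> le g f"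
proof safe
  assume f: "f \<in> carrier SM" "g \<in> carrier SM"
  {
    assume "(f, g) \<in> P"
    then show "le f g" "le g f"
      using P_add[of f g g g] P_add[of g f f f] f P_refl P_sym by (simp_all add: le_def)
  next
    assume "le f g" "le g f"
    then show "(f, g) \<in> P"
      by (metis P_sym P_trans add.commute le_def)
  }
qed

lemma zero_le: "f \<in> carrier SM \<Longrightarrow> le 0 f"
  by (simp add: le_def P_refl)

lemma le_zero_iff: "f \<in> carrier SM \<Longrightarrow> le f 0 \<longleftrightarrow> (f, 0) \<in> P"
  by (simp add: le_def)

lemma le_mult:
  assumes "le f g" "h \<in> carrier SM"
  shows "le (h * f) (h * g)"
  using P_mult[OF P_refl[OF assms(2)]] assms(1) by (simp add: le_def flip: distrib_left)

lemma le_mult_cancel: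
  assumes "f \<in> carrier SM" "g \<in> carrier SM" "h \<in> carrier SM" "(h, 0) \<notin> P" "le (h * f) (h * g)"
  shows "le f g"
  using P_cancel[of h "f + g" g] assms SM_closed by (simp add: le_def flip: distrib_left)

lemma not_zero_mult:
  assumes "f \<in> carrier SM" "g \<in> carrier SM" "(f, 0) \<notin> P" "(g, 0) \<notin> P"
  shows "(f * g, 0) \<notin> P"
  using P_cancel[of f g 0] assms SM_closed by auto

text \<open>Terms \<open>c \<chi>\<^sup>u\<close> are handled as pairs \<open>(c, u)\<close>. The set \<open>terms\<close> consists of those that are nonzero modulo \<open>P\<close>.
  They form a cancellative monoid with a total preorder, and \<open>vec\<close> maps it to \<open>\<real> \<times> M\<close>.\<close>

abbreviation mon :: "trop \<times> 'm \<Rightarrow> 'm \<Rightarrow>\<^sub>0 trop" where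
  "mon t \<equiv> Poly_Mapping.single (snd t) (fst t)"

definition terms :: "(trop \<times> 'm) set" where
  "terms = {t \<in> S \<times> M. (mon t, 0) \<notin> P}"

definition vec :: "trop \<times> 'm \<Rightarrow> real \<times> 'm" where
  "vec t = (real_of_ereal (trop_log (fst t)), snd t)"

definition tmult :: "trop \<times> 'm \<Rightarrow> trop \<times> 'm \<Rightarrow> trop \<times> 'm" where
  "tmult s t = (fst s * fst t, snd s + snd t)"

lemma mon_tmult: "mon (tmult s t) = mon s * mon t"
  by (simp add: tmult_def mult_single)

lemma mon_closed: "t \<in> S \<times> M \<Longrightarrow> mon t \<in> carrier SM"
  using single_closed by auto

lemma terms_closed: "t \<in> terms \<Longrightarrow> mon t \<in> carrier SM"
  using mon_closed by (simp add: terms_def)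

lemma terms_nonzero: "t \<in> terms \<Longrightarrow> fst t \<noteq> 0"
  using P_refl[OF SM_closed(2)] by (auto simp: terms_def)

lemma tmult_terms: "s \<in> terms \<Longrightarrow> t \<in> terms \<Longrightarrow> tmult s t \<in> terms"
  using not_zero_mult[of "mon s" "mon t"] terms_closed[of s] terms_closed[of t]
    Smult toric_monoid_closed(2)[OF \<sigma>]
  by (auto simp: terms_def mon_tmult) (auto simp: tmult_def)

lemma vec_tmult:
  assumes "s \<in> terms" "t \<in> terms"
  shows "vec (tmult s t) = vec s + vec t"
proof -
  obtain a b where "trop_log (fst s) = ereal a" "trop_log (fst t) = ereal b"
    using assms[THEN terms_nonzero] trop_log_real by metis
  then show ?thesis
    by (simp add: vec_def tmult_def)
qed

text \<open>The order of the terms, as a set of constraints on a linear form on \<open>\<real> \<times> M\<close>.\<close>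

definition N_vecs where "N_vecs = {vec s - vec t | s t. s \<in> terms \<and> t \<in> terms \<and> le (mon s) (mon t)}"

definition Str_vecs where "Str_vecs = {vec s - vec t | s t. s \<in> terms \<and> t \<in> terms \<and> \<not> le (mon t) (mon s)}"

lemma N_vecsI: "s \<in> terms \<Longrightarrow> t \<in> terms \<Longrightarrow> le (mon s) (mon t) \<Longrightarrow> vec s - vec t \<in> N_vecs"
  unfolding N_vecs_def by blast

lemma Str_vecsI: "s \<in> terms \<Longrightarrow> t \<in> terms \<Longrightarrow> \<not> le (mon t) (mon s) \<Longrightarrow> vec s - vec t \<in> Str_vecs"
  unfolding Str_vecs_def by blast

text \<open>Inequalities between terms can be multiplied, and strict ones stay strict by cancellation. If two terms have the
  same exponent, their order modulo \<open>P\<close> is implied by the order of their coefficients, so a strict inequality between them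
  is one between real numbers.\<close>

lemma half_spaces_vecs: "half_spaces N_vecs Str_vecs"
proof
  have sum: "vec (tmult s s') - vec (tmult t t') = vec s - vec t + (vec s' - vec t')"
    if "s \<in> terms" "s' \<in> terms" "t \<in> terms" "t' \<in> terms" for s s' t t'
    using that by (simp add: vec_tmult)
  show "p + q \<in> N_vecs" if pq: "p \<in> N_vecs" "q \<in> N_vecs" for p q
  proof -
    obtain s t where st: "s \<in> terms" "t \<in> terms" "le (mon s) (mon t)" "p = vec s - vec t"
      using pq(1) unfolding N_vecs_def by blast
    obtain s' t' where st': "s' \<in> terms" "t' \<in> terms" "le (mon s') (mon t')" "q = vec s' - vec t'"
      using pq(2) unfolding N_vecs_def by blast
    have "le (mon s * mon s') (mon s * mon t')"
      using st st' by (simp add: le_mult terms_closed)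
    moreover have "le (mon s * mon t') (mon t * mon t')"
      using le_mult[OF st(3) terms_closed[OF st'(2)]] by (simp only: mult.commute)
    ultimately have "le (mon (tmult s s')) (mon (tmult t t'))"
      unfolding mon_tmult by (rule le_trans[rotated 2]) (use st st' in \<open>simp_all add: SM_closed terms_closed\<close>)
    from N_vecsI[OF tmult_terms[OF st(1) st'(1)] tmult_terms[OF st(2) st'(2)] this]
    show ?thesis
      unfolding sum[OF st(1) st'(1) st(2) st'(2)] st(4) st'(4) .
  qed
  show "p + q \<in> Str_vecs" if pq: "p \<in> Str_vecs" "q \<in> N_vecs" for p q
  proof -
    obtain s t where st: "s \<in> terms" "t \<in> terms" "\<not> le (mon t) (mon s)" "p = vec s - vec t"
      using pq(1) unfolding Str_vecs_def by blast
    obtain s' t' where st': "s' \<in> terms" "t' \<in> terms" "le (mon s') (mon t')" "q = vec s' - vec t'"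
      using pq(2) unfolding N_vecs_def by blast
    have "\<not> le (mon (tmult t t')) (mon (tmult s s'))"
    proof
      assume "le (mon (tmult t t')) (mon (tmult s s'))"
      then have "le (mon t' * mon t) (mon s * mon s')"
        by (simp only: mon_tmult mult.commute)
      moreover have "le (mon s * mon s') (mon s * mon t')"
        using st st' by (simp add: le_mult terms_closed)
      ultimately have "le (mon t' * mon t) (mon s * mon t')"
        by (rule le_trans[rotated 2]) (use st st' in \<open>simp_all add: SM_closed terms_closed\<close>)
      then have "le (mon t' * mon t) (mon t' * mon s)"
        by (simp only: mult.commute)
      then show False
        using le_mult_cancel[of "mon t" "mon s" "mon t'"] st st' terms_closed by (simp add: terms_def)
    qed
    from Str_vecsI[OF tmult_terms[OF st(1) st'(1)] tmult_terms[OF st(2) st'(2)] this]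
    show ?thesis
      unfolding sum[OF st(1) st'(1) st(2) st'(2)] st(4) st'(4) .
  qed
  show "Str_vecs \<subseteq> N_vecs"
    unfolding Str_vecs_def N_vecs_def using le_total terms_closed by blast
  show "c < 0" if "(c, 0) \<in> Str_vecs" for c
  proof (rule ccontr)
    assume "\<not> c < 0"
    obtain s t where st: "s \<in> terms" "t \<in> terms" "\<not> le (mon t) (mon s)" "(c, 0) = vec s - vec t"
      using \<open>(c, 0) \<in> Str_vecs\<close> unfolding Str_vecs_def by blast
    then have eq: "snd s = snd t" and c: "c = real_of_ereal (trop_log (fst s)) - real_of_ereal (trop_log (fst t))"
      by (simp_all add: vec_def)
    have "trop_log (fst t) \<le> trop_log (fst s)"
      using \<open>\<not> c < 0\<close> c trop_log_real terms_nonzero st(1,2)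
      by (metis ereal_less_eq(3) diff_ge_0_iff_ge not_less)
    then have "fst t + fst s = fst s"
      by (simp add: max_absorb2 flip: trop_log_inject)
    then have "mon t + mon s = mon s"
      by (simp add: eq flip: single_add)
    then show False
      using st terms_closed P_refl by (simp add: le_def)
  qed
qed

text \<open>The linear form \<open>v\<close>, cut off to \<open>-\<infinity>\<close> at the exponents whose monomial is congruent to \<open>0\<close>.\<close>

definition point :: "real \<Rightarrow> ('m \<Rightarrow> real) \<Rightarrow> real \<times> ('m \<Rightarrow> ereal)" where
  "point r v = (r, \<lambda>u. if u \<notin> M then undefined else
     if (Poly_Mapping.single u 1, 0) \<in> P then -\<infinity> else ereal (v u))"

text \<open>Nonzero coefficients are invertible, so they do not influence whether a term is congruent to \<open>0\<close>.\<close>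

lemma mon_zero_iff:
  assumes "t \<in> S \<times> M"
  shows "(mon t, 0) \<in> P \<longleftrightarrow> fst t = 0 \<or> (Poly_Mapping.single (snd t) 1, 0) \<in> P"
proof (cases "fst t = 0")
  case True
  then show ?thesis by (simp add: P_refl SM_closed)
next
  case False
  then obtain d where d: "d \<in> S" "fst t * d = 1"
    using S assms by (auto simp: sub_semifield_def)
  have M0: "0 \<in> M"
    by (rule toric_monoid_closed(1)[OF \<sigma>])
  have "Poly_Mapping.single 0 d * mon t = Poly_Mapping.single (snd t) 1"
    "Poly_Mapping.single 0 (fst t) * Poly_Mapping.single (snd t) 1 = mon t"
    using d(2) by (simp_all add: mult_single mult.commute)
  moreover have "Poly_Mapping.single 0 d \<in> carrier SM" "Poly_Mapping.single 0 (fst t) \<in> carrier SM"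
    using M0 d assms by (auto intro!: single_closed)
  ultimately show ?thesis
    using False P_mult[OF P_refl] by (metis mult_zero_right)
qed

text \<open>Since \<open>P\<close> is prime, a product of monomials is congruent to \<open>0\<close> if and only if a factor is; hence the values
  \<open>-\<infinity>\<close> are compatible with addition of exponents.\<close>

lemma point_in_N_tor:
  assumes "r \<ge> 0" and v: "\<And>u w. v (u + w) = v u + v w"
  shows "point r v \<in> {0..} \<times> N_tor \<sigma>"
proof -
  let ?x = "snd (point r v)"
  note M = toric_monoid_closed[OF \<sigma>]
  have "v 0 = 0"
    using v[of 0 0] by simp
  then have "?x 0 = 0"
    using M one_not_zero by (simp add: point_def)
  moreover have "?x (u + w) = ?x u + ?x w" if "u \<in> M" "w \<in> M" for u w
  proof -
    have eq: "Poly_Mapping.single (u + w) (1::trop) = Poly_Mapping.single u 1 * Poly_Mapping.single w 1"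
      by (simp add: mult_single)
    have c: "Poly_Mapping.single u 1 \<in> carrier SM" "Poly_Mapping.single w 1 \<in> carrier SM"
      using that S1 single_closed by auto
    have "(Poly_Mapping.single (u + w) (1::trop), 0) \<in> P \<longleftrightarrow>
        (Poly_Mapping.single u 1, 0) \<in> P \<or> (Poly_Mapping.single w 1, 0) \<in> P"
      unfolding eq using not_zero_mult[OF c] P_mult[OF P_refl[OF c(1)], of "Poly_Mapping.single w 1" 0]
        P_mult[OF _ P_refl[OF c(2)], of "Poly_Mapping.single u 1" 0] by auto
    then show ?thesis
      using that M by (simp add: point_def v)
  qed
  moreover have "?x \<in> M \<rightarrow>\<^sub>E {t. t \<noteq> \<infinity>}"
    by (auto simp: point_def split: if_splits)
  ultimately show ?thesis
    using assms(1) by (auto simp: N_tor_def point_def)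
qed

text \<open>The constraints of the terms in \<open>D\<close> that are nonzero modulo \<open>P\<close> are solved by \<open>half_spaces.separation\<close>. All other
  terms have the value \<open>-\<infinity>\<close>, and they are also the smallest ones modulo \<open>P\<close>.\<close>

lemma realize_terms:
  assumes "finite D" "D \<subseteq> S \<times> M"
  obtains w where "w \<in> {0..} \<times> N_tor \<sigma>"
    "\<And>s t. s \<in> D \<Longrightarrow> t \<in> D \<Longrightarrow>
      le (mon s) (mon t) \<longleftrightarrow> term_value w (fst s) (snd s) \<le> term_value w (fst t) (snd t)"
proof -
  obtain B and \<kappa> :: "'m \<Rightarrow> 'm \<Rightarrow> int" where B: "finite B"
    "\<And>b u w. \<kappa> b (u + w) = \<kappa> b u + \<kappa> b w" "\<And>u. \<forall>b\<in>B. \<kappa> b u = 0 \<Longrightarrow> u = 0"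
    by (rule integer_coordinates[OF fg]) blast
  define D' where "D' = D \<inter> terms"
  define A where "A = {vec s - vec t | s t. s \<in> D' \<and> t \<in> D' \<and> le (mon s) (mon t)}"
  define C where "C = {vec s - vec t | s t. s \<in> D' \<and> t \<in> D' \<and> \<not> le (mon t) (mon s)}"
  have "A \<subseteq> (\<lambda>(s, t). vec s - vec t) ` (D' \<times> D')"
    by (auto simp: A_def)
  then have "finite A"
    using assms(1) by (auto simp: D'_def intro: finite_subset)
  have "A \<subseteq> N_vecs" "C \<subseteq> Str_vecs"
    unfolding A_def C_def D'_def N_vecs_def Str_vecs_def by blast+
  have "C \<subseteq> A"
    unfolding A_def C_def D'_def using le_total terms_closed by blast
  have "\<exists>r\<ge>0. \<exists>x :: 'm \<Rightarrow> real. (\<forall>p\<in>A. r * fst p + (\<Sum>b\<in>B. x b * \<kappa> b (snd p)) \<le> 0) \<and>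
      (\<forall>p\<in>C. r * fst p + (\<Sum>b\<in>B. x b * \<kappa> b (snd p)) < 0)"
    using B \<open>finite A\<close> \<open>A \<subseteq> N_vecs\<close> \<open>C \<subseteq> A\<close> \<open>C \<subseteq> Str_vecs\<close>
    by (intro half_spaces.separation[OF half_spaces_vecs]) blast+
  then obtain r :: real and x :: "'m \<Rightarrow> real" where r: "r \<ge> 0"
    and rx: "\<forall>p\<in>A. r * fst p + (\<Sum>b\<in>B. x b * \<kappa> b (snd p)) \<le> 0"
      "\<forall>p\<in>C. r * fst p + (\<Sum>b\<in>B. x b * \<kappa> b (snd p)) < 0"
    by blast
  define v where "v = (\<lambda>u. \<Sum>b\<in>B. x b * \<kappa> b u)"
  have v: "v (u + w) = v u + v w" for u w
    by (simp add: v_def B(2) distrib_left sum.distrib)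
  then have v_diff: "v (u - w) = v u - v w" for u w
    by (metis add_diff_cancel diff_add_cancel)
  define w where "w = point r v"
  define val where "val = (\<lambda>t :: trop \<times> 'm. r * real_of_ereal (trop_log (fst t)) + v (snd t))"
  have tv: "term_value w (fst t) (snd t) = (if t \<in> terms then ereal (val t) else -\<infinity>)" if "t \<in> D" for t
  proof (cases "fst t = 0")
    case True
    then show ?thesis
      using terms_nonzero[of t] by (auto simp: term_value_def)
  next
    case False
    moreover have "t \<in> S \<times> M" "snd t \<in> M"
      using that assms(2) by auto
    ultimately show ?thesis
      using mon_zero_iff[of t] by (simp add: term_value_real w_def point_def val_def terms_def)
  qed
  have vsum: "(\<Sum>b\<in>B. x b * \<kappa> b u) = v u" for u
    by (simp add: v_def)
  have diff: "r * fst (vec s - vec t) + (\<Sum>b\<in>B. x b * \<kappa> b (snd (vec s - vec t))) = val s - val t" for s t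
    unfolding vsum by (simp add: val_def vec_def v_diff algebra_simps)
  show ?thesis
  proof (rule that[of w])
    show "w \<in> {0..} \<times> N_tor \<sigma>"
      unfolding w_def using r v by (rule point_in_N_tor)
  next
    fix s t assume st: "s \<in> D" "t \<in> D"
    then have c: "mon s \<in> carrier SM" "mon t \<in> carrier SM"
      using assms(2) mon_closed by blast+
    have neg: "s \<notin> terms \<longleftrightarrow> le (mon s) 0" "t \<notin> terms \<longleftrightarrow> le (mon t) 0"
      using st assms(2) c by (auto simp: terms_def le_zero_iff)
    show "le (mon s) (mon t) \<longleftrightarrow> term_value w (fst s) (snd s) \<le> term_value w (fst t) (snd t)"
    proof (cases "s \<in> terms \<and> t \<in> terms")
      case True
      then have D': "s \<in> D'" "t \<in> D'"
        using st by (simp_all add: D'_def)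
      have "val s - val t \<le> 0" if "le (mon s) (mon t)"
      proof -
        have "vec s - vec t \<in> A"
          unfolding A_def using that D' by blast
        from bspec[OF rx(1) this] show ?thesis
          unfolding diff .
      qed
      moreover have "val t - val s < 0" if "\<not> le (mon s) (mon t)"
      proof -
        have "vec t - vec s \<in> C"
          unfolding C_def using that D' by blast
        from bspec[OF rx(2) this] show ?thesis
          unfolding diff .
      qed
      ultimately show ?thesis
        using True st by (force simp: tv)
    next
      case False
      then consider "s \<notin> terms" | "s \<in> terms" "t \<notin> terms" by blast
      then show ?thesis
      proof cases
        case 1
        then have "le (mon s) (mon t)"
          using neg zero_le c le_trans by blast
        with 1 show ?thesis by (simp add: tv st)
      next
        case 2
        then have "\<not> le (mon s) (mon t)"
          using neg c le_trans SM_closed(2) by blast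
        with 2 show ?thesis by (simp add: tv st)
      qed
    qed
  qed
qed

text \<open>The exponent \<open>0\<close> is always included, possibly with the coefficient \<open>0\<close>, so that the set is not empty for the
  zero polynomial.\<close>

definition coeff_terms :: "('m \<Rightarrow>\<^sub>0 trop) \<Rightarrow> (trop \<times> 'm) set" where
  "coeff_terms f = (\<lambda>u. (Poly_Mapping.lookup f u, u)) ` insert 0 (Poly_Mapping.keys f)"

lemma coeff_terms_sub: "f \<in> carrier SM \<Longrightarrow> coeff_terms f \<subseteq> S \<times> M"
  using toric_monoid_closed(1)[OF \<sigma>] by (auto simp: coeff_terms_def carrier_SM_iff)

text \<open>In a totally ordered quotient a sum is equal to its largest summand.\<close>

lemma sum_dominant_term:
  assumes "finite X" "X \<noteq> {}" "X \<subseteq> S \<times> M"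
  shows "\<exists>t\<in>X. (sum mon X, mon t) \<in> P \<and> (\<forall>s\<in>X. le (mon s) (mon t))"
  using assms
proof (induction X rule: finite_ne_induct)
  case (singleton t)
  then show ?case
    using mon_closed P_refl le_refl by auto
next
  case (insert s X)
  then obtain t where t: "t \<in> X" "(sum mon X, mon t) \<in> P" "\<forall>s\<in>X. le (mon s) (mon t)"
    by auto
  have c: "mon s' \<in> carrier SM" if "s' \<in> insert s X" for s'
    using insert.prems that mon_closed by blast
  have eq: "(sum mon (insert s X), mon s + mon t) \<in> P"
    using insert.hyps P_add[OF P_refl[OF c[of s]] t(2)] by simp
  consider "le (mon s) (mon t)" | "le (mon t) (mon s)"
    using le_total c t(1) by blast
  then show ?case
  proof cases
    case 1
    then have "(sum mon (insert s X), mon t) \<in> P"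
      using eq P_trans by (auto simp: le_def)
    with 1 t show ?thesis by blast
  next
    case 2
    then have "(sum mon (insert s X), mon s) \<in> P"
      using eq P_trans by (auto simp: le_def add.commute)
    moreover have "le (mon s') (mon s)" if "s' \<in> insert s X" for s'
    proof (cases "s' = s")
      case True
      then show ?thesis using c le_refl by blast
    next
      case False
      then have "le (mon s') (mon t)"
        using t(3) that by blast
      then show ?thesis
        using le_trans[OF c[OF that] c[of s] _ 2] by blast
    qed
    ultimately show ?thesis by blast
  qed
qed

lemma dominant_term:
  assumes f: "f \<in> carrier SM"
  shows "\<exists>t\<in>coeff_terms f. (f, mon t) \<in> P \<and> (\<forall>s\<in>coeff_terms f. le (mon s) (mon t))"
proof -
  have "sum mon (coeff_terms f)
      = (\<Sum>u\<in>insert 0 (Poly_Mapping.keys f). Poly_Mapping.single u (Poly_Mapping.lookup f u))"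
    unfolding coeff_terms_def by (subst sum.reindex) (auto simp: inj_on_def o_def)
  also have "\<dots> = f"
    by (rule sum_of_terms) auto
  finally show ?thesis
    using sum_dominant_term[of "coeff_terms f"] coeff_terms_sub[OF f] by (auto simp: coeff_terms_def)
qed

text \<open>Each polynomial is congruent to its dominant term modulo \<open>P\<close>, and at a point that orders the terms like \<open>P\<close> it has
  the value of this term.\<close>

theorem realize_prime:
  assumes "finite G" "G \<subseteq> carrier SM"
  obtains w where "w \<in> {0..} \<times> N_tor \<sigma>"
    "\<And>f g. f \<in> G \<Longrightarrow> g \<in> G \<Longrightarrow> (f, g) \<in> P \<longleftrightarrow> tilde f w = tilde g w"
proof -
  define D where "D = (\<Union>f\<in>G. coeff_terms f)"
  have "finite D" "D \<subseteq> S \<times> M"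
    using assms coeff_terms_sub by (auto simp: D_def coeff_terms_def)
  then obtain w where w: "w \<in> {0..} \<times> N_tor \<sigma>"
    and le: "\<And>s t. s \<in> D \<Longrightarrow> t \<in> D \<Longrightarrow>
      le (mon s) (mon t) \<longleftrightarrow> term_value w (fst s) (snd s) \<le> term_value w (fst t) (snd t)"
    by (rule realize_terms) blast
  have dom: "\<exists>t\<in>D. (f, mon t) \<in> P \<and> tilde f w = term_value w (fst t) (snd t)" if "f \<in> G" for f
  proof -
    obtain t where t: "t \<in> coeff_terms f" "(f, mon t) \<in> P" "\<forall>s\<in>coeff_terms f. le (mon s) (mon t)"
      using dominant_term[of f] assms(2) \<open>f \<in> G\<close> by blast
    have sub: "coeff_terms f \<subseteq> D"
      using \<open>f \<in> G\<close> by (auto simp: D_def)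
    have "tilde f w = term_value w (fst t) (snd t)"
      unfolding tilde_eq_SUP
    proof (rule antisym)
      show "(SUP u. term_value w (Poly_Mapping.lookup f u) u) \<le> term_value w (fst t) (snd t)"
      proof (rule SUP_least)
        fix u
        show "term_value w (Poly_Mapping.lookup f u) u \<le> term_value w (fst t) (snd t)"
        proof (cases "u \<in> Poly_Mapping.keys f")
          case True
          then have "(Poly_Mapping.lookup f u, u) \<in> coeff_terms f"
            by (simp add: coeff_terms_def)
          then show ?thesis
            using t le sub by fastforce
        next
          case False
          then show ?thesis
            by (simp add: not_in_keys_iff_lookup_eq_zero term_value_def)
        qed
      qed
      have "fst t = Poly_Mapping.lookup f (snd t)"
        using t(1) by (auto simp: coeff_terms_def)
      then show "term_value w (fst t) (snd t) \<le> (SUP u. term_value w (Poly_Mapping.lookup f u) u)"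
        using SUP_upper[of "snd t" UNIV "\<lambda>u. term_value w (Poly_Mapping.lookup f u) u"] by simp
    qed
    then show ?thesis
      using t sub by blast
  qed
  show ?thesis
  proof (rule that[OF w])
    fix f g assume fg: "f \<in> G" "g \<in> G"
    obtain s t where s: "s \<in> D" "(f, mon s) \<in> P" "tilde f w = term_value w (fst s) (snd s)"
      and t: "t \<in> D" "(g, mon t) \<in> P" "tilde g w = term_value w (fst t) (snd t)"
      using dom fg by blast
    have "(f, g) \<in> P \<longleftrightarrow> (mon s, mon t) \<in> P"
      using s(2) t(2) P_sym P_trans by blast
    also have "\<dots> \<longleftrightarrow> le (mon s) (mon t) \<and> le (mon t) (mon s)"
      using P_sub s(2) t(2) by (intro P_iff_le) auto
    also have "\<dots> \<longleftrightarrow> tilde f w = tilde g w"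
      using le s t by auto
    finally show "(f, g) \<in> P \<longleftrightarrow> tilde f w = tilde g w" .
  qed
qed

end

section \<open>Minimal primes\<close>

text \<open>The finite tropical basis turns \<open>w \<in> V_tilde \<sigma> E\<close> into finitely many conditions, so that \<open>realize_prime\<close> provides
  a point on \<open>V_tilde \<sigma> E\<close> at which the pairs in \<open>Z\<close> are separated. Density of the finite points then allows it to be
  moved to a finite one.\<close>

lemma separate_at_finite_point:
  fixes \<sigma> :: "('m::ab_group_add \<Rightarrow> real) set"
  assumes "toric_prime \<sigma> S P" and "E \<subseteq> P" "finite_tropical_basis \<sigma> E"
    and clos: "V_tilde \<sigma> E = prod_topology (top_of_set {0::real..}) (N_tor_top \<sigma>) closure_of
           (V_tilde \<sigma> E \<inter> ({0..} \<times> N_fin \<sigma>))"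
    and Z: "finite Z" "Z \<subseteq> carrier (monoid_semiring S (toric_monoid \<sigma>)) \<times> carrier (monoid_semiring S (toric_monoid \<sigma>)) - P"
  shows "\<exists>w \<in> V_tilde \<sigma> E \<inter> ({0..} \<times> N_fin \<sigma>). \<forall>p\<in>Z. tilde (fst p) w \<noteq> tilde (snd p) w"
proof -
  interpret toric_prime \<sigma> S P by fact
  let ?T = "prod_topology (top_of_set {0::real..}) (N_tor_top \<sigma>)"
  obtain F where F: "finite F" "F \<subseteq> E" "V_tilde \<sigma> E = V_tilde \<sigma> F"
    using assms(3) by (auto simp: finite_tropical_basis_def)
  define G where "G = fst ` (F \<union> Z) \<union> snd ` (F \<union> Z)"
  have "finite G" "G \<subseteq> carrier SM"
  proof -
    have "F \<union> Z \<subseteq> carrier SM \<times> carrier SM"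
      using F(2) Z(2) \<open>E \<subseteq> P\<close> P_sub by blast
    then show "G \<subseteq> carrier SM"
      by (auto simp: G_def)
    show "finite G"
      using F(1) Z(1) by (simp add: G_def)
  qed
  then obtain w where w: "w \<in> {0..} \<times> N_tor \<sigma>"
    and eq: "\<And>f g. f \<in> G \<Longrightarrow> g \<in> G \<Longrightarrow> (f, g) \<in> P \<longleftrightarrow> tilde f w = tilde g w"
    by (rule realize_prime) blast
  have G: "fst p \<in> G" "snd p \<in> G" if "p \<in> F \<union> Z" for p
    using that by (auto simp: G_def)
  have "tilde (fst p) w = tilde (snd p) w" if "p \<in> F" for p
    using eq[of "fst p" "snd p"] G[of p] that F(2) \<open>E \<subseteq> P\<close> by auto
  then have "w \<in> V_tilde \<sigma> E"
    unfolding F(3) using w by (auto simp: V_tilde_def)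
  have "tilde (fst p) w \<noteq> tilde (snd p) w" if "p \<in> Z" for p
    using eq[of "fst p" "snd p"] G[of p] that Z(2) by auto
  define V where "V = {w \<in> topspace ?T. \<forall>p\<in>Z. tilde (fst p) w \<noteq> tilde (snd p) w}"
  have "openin ?T V"
  proof -
    have "V = (\<Inter>p\<in>Z. {w \<in> topspace ?T. tilde (fst p) w \<noteq> tilde (snd p) w}) \<inter> topspace ?T"
      by (auto simp: V_def)
    also have "openin ?T \<dots>"
      using Z by (intro openin_INT openin_tilde_neq) auto
    finally show ?thesis .
  qed
  moreover have "w \<in> V"
    using w \<open>\<And>p. p \<in> Z \<Longrightarrow> tilde (fst p) w \<noteq> tilde (snd p) w\<close> by (auto simp: V_def topspace_N_tor_top)
  moreover have "w \<in> ?T closure_of (V_tilde \<sigma> E \<inter> ({0..} \<times> N_fin \<sigma>))"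
    using \<open>w \<in> V_tilde \<sigma> E\<close> clos by simp
  ultimately obtain w' where "w' \<in> V_tilde \<sigma> E \<inter> ({0..} \<times> N_fin \<sigma>)" "w' \<in> V"
    unfolding in_closure_of by blast
  then show ?thesis
    unfolding V_def by blast
qed

text \<open>\<open>Q\<close> is the limit along an ultrafilter \<open>U\<close> that contains, for each pair outside \<open>P\<close>, the set of finite points of
  \<open>V_tilde \<sigma> E\<close> separating the pair. The previous lemma says that these sets have the finite intersection property.\<close>

lemma prime_below_with_trivial_kernel:
  fixes \<sigma> :: "('m::ab_group_add \<Rightarrow> real) set" and S :: "trop set"
  defines "A \<equiv> monoid_semiring S (toric_monoid \<sigma>)"
  assumes P: "toric_prime \<sigma> S P" and E: "E \<subseteq> P" "finite_tropical_basis \<sigma> E"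
    and clos: "V_tilde \<sigma> E = prod_topology (top_of_set {0::real..}) (N_tor_top \<sigma>) closure_of
           (V_tilde \<sigma> E \<inter> ({0..} \<times> N_fin \<sigma>))"
  shows "\<exists>Q. prime_congruence A Q \<and> E \<subseteq> Q \<and> Q \<subseteq> P \<and> (\<forall>f. (f, 0) \<in> Q \<longrightarrow> f = 0)"
proof -
  interpret toric_prime \<sigma> S P by fact
  define W where "W = V_tilde \<sigma> E \<inter> ({0..} \<times> N_fin \<sigma>)"
  define sep where "sep = (\<lambda>p. principal (W \<inter> {w. tilde (fst p) w \<noteq> tilde (snd p) w}))"
  define Z where "Z = carrier A \<times> carrier A - P"
  have "(INF p\<in>Z. sep p) \<noteq> bot"
  proof (rule INF_filter_not_bot)
    fix X assume X: "X \<subseteq> Z" "finite X"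
    define WX where "WX = W \<inter> {w. \<forall>p\<in>X. tilde (fst p) w \<noteq> tilde (snd p) w}"
    have "principal WX \<le> (INF p\<in>X. sep p)"
      by (rule INF_greatest) (auto simp: sep_def WX_def)
    moreover have "\<exists>w\<in>W. \<forall>p\<in>X. tilde (fst p) w \<noteq> tilde (snd p) w"
      unfolding W_def by (rule separate_at_finite_point[OF P E clos]) (use X in \<open>auto simp: Z_def A_def\<close>)
    then have "WX \<noteq> {}"
      by (auto simp: WX_def)
    ultimately show "(INF p\<in>X. sep p) \<noteq> bot"
      using principal_eq_bot_iff[of WX] by (metis bot.extremum_uniqueI)
  qed
  then obtain U where U: "U \<le> (INF p\<in>Z. sep p)" "ultra U"
    using ultra_exists by blast
  \<comment> \<open>At least one pair lies outside \<open>P\<close>, and this is why \<open>U\<close> is concentrated on \<open>W\<close>.\<close>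
  have "(1, 0) \<in> Z"
    using SM_closed one_not_zero by (simp add: Z_def A_def)
  have sepU: "eventually (\<lambda>w. w \<in> W \<and> tilde f w \<noteq> tilde g w) U" if "(f, g) \<in> Z" for f g
    using U(1) that by (auto simp: le_INF_iff sep_def le_principal)
  have evW: "eventually (\<lambda>w. w \<in> W) U"
    using sepU[OF \<open>(1, 0) \<in> Z\<close>] by (rule eventually_mono) simp
  have "N_fin \<sigma> \<subseteq> N_tor \<sigma>"
    by (auto simp: N_fin_def)
  then have "eventually (\<lambda>w. w \<in> {0..} \<times> N_tor \<sigma>) U"
    using evW by (auto simp: W_def elim!: eventually_mono)
  then have prime: "prime_congruence A (ultra_congruence U)"
    unfolding A_def by (rule prime_ultra_congruence[OF U(2)])
  have "E \<subseteq> ultra_congruence U"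
  proof
    fix p assume p: "p \<in> E"
    have "eventually (\<lambda>w. tilde (fst p) w = tilde (snd p) w) U"
      using evW by (rule eventually_mono) (use p in \<open>auto simp: W_def V_tilde_def\<close>)
    moreover have "p \<in> carrier SM \<times> carrier SM"
      using p E(1) P_sub by blast
    ultimately show "p \<in> ultra_congruence U"
      by (auto simp: ultra_congruence_def)
  qed
  moreover have "ultra_congruence U \<subseteq> P"
  proof clarify
    fix f g assume Q: "(f, g) \<in> ultra_congruence U"
    show "(f, g) \<in> P"
    proof (rule ccontr)
      assume "(f, g) \<notin> P"
      with Q have "(f, g) \<in> Z"
        by (auto simp: Z_def A_def ultra_congruence_def)
      from sepU[OF this] have "eventually (\<lambda>w. tilde f w \<noteq> tilde g w) U"
        by (rule eventually_mono) simp
      then show False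
        using Q ultra_eventually_not[OF U(2), of "\<lambda>w. tilde f w = tilde g w"]
        by (auto simp: ultra_congruence_def)
    qed
  qed
  moreover have "f = 0" if "(f, 0) \<in> ultra_congruence U" for f
  proof -
    have f: "f \<in> carrier SM" "eventually (\<lambda>w. tilde f w = -\<infinity>) U"
      using that by (auto simp: ultra_congruence_def)
    then have "eventually (\<lambda>w. tilde f w = -\<infinity> \<and> w \<in> W) U"
      using evW by (simp add: eventually_conj_iff)
    moreover have "U \<noteq> bot"
      using U(2) by (simp add: ultra_def)
    ultimately obtain w where "tilde f w = -\<infinity>" "w \<in> W"
      using eventually_happens' by blast
    then show ?thesis
      using tilde_finite[OF _ f(1)] unfolding W_def by blast
  qed
  ultimately show ?thesis
    using prime by blast
qed

theorem theorem1p3: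
  fixes \<sigma> :: "('m::ab_group_add \<Rightarrow> real) set"
    and S :: "trop set"
    and E :: "(('m \<Rightarrow>\<^sub>0 trop) \<times> ('m \<Rightarrow>\<^sub>0 trop)) set"
  assumes "fg_free_abelian TYPE('m)"
    and "rational_polyhedral_cone \<sigma>" and "strongly_convex \<sigma>"
    and "sub_semifield S"
    and "congruence (monoid_semiring S (toric_monoid \<sigma>)) E"
    and "finite_tropical_basis \<sigma> E"
    and "V_tilde \<sigma> E = prod_topology (top_of_set {0::real..}) (N_tor_top \<sigma>) closure_of
           (V_tilde \<sigma> E \<inter> ({0..} \<times> N_fin \<sigma>))"
  shows "\<forall>P. minimal_prime_congruence
               (quot_semiring (monoid_semiring S (toric_monoid \<sigma>)) E) P \<longrightarrow>
             ideal_kernel (quot_semiring (monoid_semiring S (toric_monoid \<sigma>)) E) P =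
               {\<zero>\<^bsub>quot_semiring (monoid_semiring S (toric_monoid \<sigma>)) E\<^esub>}"
proof (intro allI impI)
  let ?A = "monoid_semiring S (toric_monoid \<sigma>)"
  fix P assume P: "minimal_prime_congruence (quot_semiring ?A E) P"
  interpret toric_semiring \<sigma> S
    using assms(2,4) by (rule toric_semiring.intro)
  interpret semiring_with_congruence ?A E
    using semiring_SM assms(5)
    by (simp add: semiring_with_congruence_def semiring_with_congruence_axioms_def)
  have prime: "prime_congruence (quot_semiring ?A E) P"
    using P by (simp add: minimal_prime_congruence_def)
  then have "E \<subseteq> pull_congruence ?A E P"
    by (intro pull_contains) (simp add: prime_congruence_def proper_congruence_def)
  moreover have "toric_prime \<sigma> S (pull_congruence ?A E P)"
    using assms(1,2,4) prime_pull[OF prime] by unfold_locales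
  ultimately obtain Q where Q: "prime_congruence ?A Q" "E \<subseteq> Q" "Q \<subseteq> pull_congruence ?A E P"
    and ker: "\<forall>f. (f, 0) \<in> Q \<longrightarrow> f = 0"
    using prime_below_with_trivial_kernel[OF _ _ assms(6,7)] by blast
  show "ideal_kernel (quot_semiring ?A E) P = {\<zero>\<^bsub>quot_semiring ?A E\<^esub>}"
    using P Q
  proof (rule ideal_kernel_minimal_prime)
    show "f = \<zero>\<^bsub>?A\<^esub>" if "(f, \<zero>\<^bsub>?A\<^esub>) \<in> Q" for f
      using ker that unfolding SM_ops by blast
  qed
qed

end
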